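(* Let $r\ge1$ be an integer. For any nice coloring of the tangent bundle of the real projective space $\mathbb{R}P^{2^r}$, there are at least three pairs $\{\sigma,inv(\sigma)\}$ of simplices with $Alt(\sigma)\ge 2^{r+1}-2$.
   Context: For a vector bundle $V\to B$ over a closed manifold, choose a fiberwise metric and let $E=S(V)$ be the unit sphere bundle, with the involution $inv:E\to E$, $v\mapsto -v$. A nice coloring of $V$ consists of a triangulation of $E$ for which $inv$ is simplicial (maps simplices linearly to simplices), together with a labeling $\lambda:\mathrm{Vert}(E)\to\{\pm1,\dots,\pm N\}$ for some $N$, such that $\lambda(inv(v))=-\lambda(v)$ for every vertex $v$ and $\lambda(v)\ne-\lambda(w)$ for all pairs of adjacent vertices $v,w$. Alternating number. For a simplex $\sigma$ of $E$, $Alt(\sigma)$ is the number of sign changes in the sequence of the distinct labels of the vertices of $\sigma$, ordered by absolute value. Simplices of all dimensions are counted. *)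

theory Defs
  imports "HOL-Analysis.Analysis"
begin

section \<open>Quotient topologies\<close>

definition quotient_topology :: "'a topology \<Rightarrow> ('a \<Rightarrow> 'b) \<Rightarrow> 'b topology" where
  "quotient_topology X q =
     topology (\<lambda>U. U \<subseteq> q ` topspace X \<and> openin X {x \<in> topspace X. q x \<in> U})"

lemma openin_quotient_topology:
  "openin (quotient_topology X q) U \<longleftrightarrow>
     U \<subseteq> q ` topspace X \<and> openin X {x \<in> topspace X. q x \<in> U}"
proof -
  have "istopology (\<lambda>U. U \<subseteq> q ` topspace X \<and> openin X {x \<in> topspace X. q x \<in> U})"
    unfolding istopology_def
  proof (intro conjI allI impI; (elim conjE)?)
    fix S T
    assume "openin X {x \<in> topspace X. q x \<in> S}" "openin X {x \<in> topspace X. q x \<in> T}"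
    moreover have "{x \<in> topspace X. q x \<in> S \<inter> T} =
        {x \<in> topspace X. q x \<in> S} \<inter> {x \<in> topspace X. q x \<in> T}" by auto
    ultimately show "openin X {x \<in> topspace X. q x \<in> S \<inter> T}" by auto
  next
    fix \<K>
    assume "\<forall>K\<in>\<K>. K \<subseteq> q ` topspace X \<and> openin X {x \<in> topspace X. q x \<in> K}"
    moreover have "{x \<in> topspace X. q x \<in> \<Union>\<K>} = (\<Union>K\<in>\<K>. {x \<in> topspace X. q x \<in> K})" by auto
    ultimately show "openin X {x \<in> topspace X. q x \<in> \<Union>\<K>}" by auto
  qed blast+
  then show ?thesis
    by (simp add: quotient_topology_def topology_inverse')
qed

lemma topspace_quotient_topology: "topspace (quotient_topology X q) = q ` topspace X"
proof
  show "topspace (quotient_topology X q) \<subseteq> q ` topspace X"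
    by (auto simp: topspace_def[of "quotient_topology X q"] openin_quotient_topology)
  have "{x \<in> topspace X. q x \<in> q ` topspace X} = topspace X" by auto
  then have "openin (quotient_topology X q) (q ` topspace X)"
    by (simp add: openin_quotient_topology)
  then show "q ` topspace X \<subseteq> topspace (quotient_topology X q)"
    by (rule openin_subset)
qed

lemma quotient_map_quotient_topology: "quotient_map X (quotient_topology X q) q"
  by (auto simp: quotient_map_def topspace_quotient_topology openin_quotient_topology)


section \<open>Vector bundles, fiberwise metrics and sphere bundles\<close>

text \<open>The data of a real vector bundle. The operations only matter on pairs of points in
  a common fiber; the zero vector of the fiber of \<open>c\<close> is \<open>fscale V 0 c\<close>.\<close>

record ('e, 'b) vbundle =
  total :: "'e topology"
  base :: "'b topology"
  proj :: "'e \<Rightarrow> 'b"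
  fadd :: "'e \<Rightarrow> 'e \<Rightarrow> 'e"
  fscale :: "real \<Rightarrow> 'e \<Rightarrow> 'e"

definition fiber :: "('e, 'b) vbundle \<Rightarrow> 'b \<Rightarrow> 'e set" where
  "fiber V b = {c \<in> topspace (total V). proj V c = b}"

definition fiberwise_metric :: "('e, 'b) vbundle \<Rightarrow> ('e \<Rightarrow> 'e \<Rightarrow> real) \<Rightarrow> bool" where
  "fiberwise_metric V g \<longleftrightarrow>
     continuous_map
       (subtopology (prod_topology (total V) (total V)) {(c, d). proj V c = proj V d})
       euclideanreal (\<lambda>(c, d). g c d) \<and>
     (\<forall>b \<in> topspace (base V).
        (\<forall>c \<in> fiber V b. \<forall>d \<in> fiber V b. g c d = g d c) \<and>
        (\<forall>c \<in> fiber V b. \<forall>d \<in> fiber V b. \<forall>e \<in> fiber V b.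
           g (fadd V c d) e = g c e + g d e) \<and>
        (\<forall>a. \<forall>c \<in> fiber V b. \<forall>d \<in> fiber V b. g (fscale V a c) d = a * g c d) \<and>
        (\<forall>c \<in> fiber V b. c \<noteq> fscale V 0 c \<longrightarrow> g c c > 0))"

definition sphere_bundle :: "('e, 'b) vbundle \<Rightarrow> ('e \<Rightarrow> 'e \<Rightarrow> real) \<Rightarrow> 'e topology" where
  "sphere_bundle V g = subtopology (total V) {c. g c c = 1}"

definition antipode :: "('e, 'b) vbundle \<Rightarrow> 'e \<Rightarrow> 'e" where
  "antipode V = fscale V (-1)"


section \<open>The tangent bundle of real projective space\<close>

text \<open>With \<open>CARD('n) = n + 1\<close>, the type \<open>real^'n\<close> is the ambient space of \<open>S\<^sup>n\<close>.
  Projective \<open>n\<close>-space is the quotient of \<open>S\<^sup>n\<close> by the antipodal map, and its tangent bundle is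
  the quotient of \<open>T S\<^sup>n = {(x, v). norm x = 1 \<and> x \<bullet> v = 0}\<close> by the differential
  \<open>(x, v) \<mapsto> (- x, - v)\<close> of the antipodal map. Points are the two-element orbits.\<close>

definition orbit_pm :: "'a::uminus \<Rightarrow> 'a set" where
  "orbit_pm p = {p, - p}"

definition real_projective_space :: "(real^'n) set topology" where
  "real_projective_space = quotient_topology (top_of_set (sphere 0 1)) orbit_pm"

definition tangent_sphere :: "((real^'n) \<times> (real^'n)) set" where
  "tangent_sphere = {(x, v). norm x = 1 \<and> x \<bullet> v = 0}"

definition tangent_RP :: "(((real^'n) \<times> (real^'n)) set, (real^'n) set) vbundle" where
  "tangent_RP =
     \<lparr> total = quotient_topology (top_of_set tangent_sphere) orbit_pm,
       base = real_projective_space,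
       proj = (\<lambda>c. fst ` c),
       fadd = (\<lambda>c d. {(x, v + w) | x v w. (x, v) \<in> c \<and> (x, w) \<in> d}),
       fscale = (\<lambda>a c. (\<lambda>(x, v). (x, a *\<^sub>R v)) ` c) \<rparr>"

lemma proj_tangent_RP: "proj tangent_RP (orbit_pm (x, v)) = orbit_pm x"
  by (simp add: tangent_RP_def orbit_pm_def)

lemma fadd_tangent_RP:
  assumes "norm x = 1"
  shows "fadd tangent_RP (orbit_pm (x, v)) (orbit_pm (x, w)) = orbit_pm (x, v + w)"
proof -
  have "x \<noteq> - x"
  proof
    assume "x = - x"
    then have "x $ i = - x $ i" for i by (metis vector_uminus_component)
    then have "x = 0" by (simp add: vec_eq_iff)
    with assms show False by simp
  qed
  then show ?thesis
    by (auto simp: tangent_RP_def orbit_pm_def)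
qed

lemma fscale_tangent_RP:
  "fscale tangent_RP a (orbit_pm (x, v)) = orbit_pm (x, a *\<^sub>R v)"
  by (simp add: tangent_RP_def orbit_pm_def)


section \<open>Nice colorings\<close>

definition vertices :: "'k::euclidean_space set set \<Rightarrow> 'k set" where
  "vertices K = {v. {v} \<in> K}"

text \<open>A triangulation of a space \<open>E\<close> is a geometric simplicial complex \<open>K\<close> together with a
  homeomorphism \<open>h\<close> from its polyhedron to \<open>E\<close>. A self-map of \<open>E\<close> is transported to the
  polyhedron along \<open>h\<close>.\<close>

definition triangulates ::
    "'k::euclidean_space set set \<Rightarrow> ('k \<Rightarrow> 'e) \<Rightarrow> 'e topology \<Rightarrow> bool" where
  "triangulates K h E \<longleftrightarrow>
     simplicial_complex K \<and> homeomorphic_map (top_of_set (\<Union>K)) E h"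

definition transport ::
    "'k::euclidean_space set set \<Rightarrow> ('k \<Rightarrow> 'e) \<Rightarrow> ('e \<Rightarrow> 'e) \<Rightarrow> 'k \<Rightarrow> 'k" where
  "transport K h i = (\<lambda>x. inv_into (\<Union>K) h (i (h x)))"

definition simplicial_self_map :: "'k::euclidean_space set set \<Rightarrow> ('k \<Rightarrow> 'k) \<Rightarrow> bool" where
  "simplicial_self_map K f \<longleftrightarrow>
     (\<forall>\<sigma>\<in>K. f ` \<sigma> \<in> K \<and>
        (\<forall>x\<in>\<sigma>. \<forall>y\<in>\<sigma>. \<forall>t\<in>{0..1}.
           f ((1 - t) *\<^sub>R x + t *\<^sub>R y) = (1 - t) *\<^sub>R f x + t *\<^sub>R f y))"

definition nice_coloring ::
    "('e, 'b) vbundle \<Rightarrow> ('e \<Rightarrow> 'e \<Rightarrow> real) \<Rightarrow>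
     'k::euclidean_space set set \<Rightarrow> ('k \<Rightarrow> 'e) \<Rightarrow> ('k \<Rightarrow> int) \<Rightarrow> bool" where
  "nice_coloring V g K h lab \<longleftrightarrow>
     triangulates K h (sphere_bundle V g) \<and>
     simplicial_self_map K (transport K h (antipode V)) \<and>
     (\<exists>N::nat. \<forall>v \<in> vertices K. lab v \<noteq> 0 \<and> \<bar>lab v\<bar> \<le> int N) \<and>
     (\<forall>v \<in> vertices K. lab (transport K h (antipode V) v) = - lab v) \<and>
     (\<forall>v \<in> vertices K. \<forall>w \<in> vertices K.
        v \<noteq> w \<and> closed_segment v w \<in> K \<longrightarrow> lab v \<noteq> - lab w)"

fun sign_changes :: "int list \<Rightarrow> nat" where
  "sign_changes (a # b # xs) = (if sgn a \<noteq> sgn b then 1 else 0) + sign_changes (b # xs)"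
| "sign_changes _ = 0"

definition Alt :: "'k::euclidean_space set set \<Rightarrow> ('k \<Rightarrow> int) \<Rightarrow> 'k set \<Rightarrow> nat" where
  "Alt K lab \<sigma> =
     sign_changes (sort_key abs (sorted_list_of_set (lab ` (vertices K \<inter> \<sigma>))))"

end

theory Submission
  imports Defs "HOL-Library.Poly_Mapping" "HOL-Library.Sublist"
begin

text \<open>Let \<open>n = 2\<^sup>r\<close>. Points of the sphere bundle are orthonormal pairs \<open>(x, y)\<close> modulo
  \<open>(x, y) \<mapsto> (- x, - y)\<close>, so a nice coloring pulls back to labels on pairs of vectors that change
  sign when either vector does; the sign of \<open>x \<bullet> y\<close> gives one more label on the pairs that are not
  orthogonal. Counting alternating simplices modulo 2, as in Ky Fan's proof of Tucker's lemma,
  gives \<open>a i j = a (i - 1) j + a i (j - 1)\<close> for the product of spheres \<open>S\<^sup>i \<times> S\<^sup>j\<close> with independent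
  sign changes of the factors, hence \<open>a i j = (i + j choose i)\<close>. This is odd for \<open>i = n - 1\<close> and
  \<open>j = n\<close>, and dropping the extra label leaves a simplex of dimension \<open>2 n - 2\<close> whose labels
  alternate. It has two proper cofaces because the sphere bundle is a manifold of dimension
  \<open>2 n - 1\<close> without boundary. No simplex contains a vertex together with its antipode, so the
  three simplices belong to different pairs.\<close>


section \<open>Ordered simplicial chains and barycentric subdivision\<close>

text \<open>A pair of labels \<open>k\<close>, \<open>- k\<close> acts as a coordinate that changes
  sign under either flip, hence as a section of the tensor product of the tautological line bundles
  over a product of two projective spaces. The class of that bundle is \<open>x + y\<close>, and the
  binomial coefficient is the coefficient of \<open>x^i y^j\<close> in
  \<open>(x + y)^(i + j)\<close>. The inner product is one more such coordinate, whose zeros are the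
  orthogonal pairs. On two spheres of dimension \<open>n\<close> the count
  \<open>(2n choose n)\<close> is even; one dimension less in one factor gives half of it,
  \<open>(2n - 1 choose n - 1)\<close>, which is odd exactly if \<open>n\<close> is a power of two.
  The obstacle is that a triangulation of the sphere bundle induces none on the product of spheres.
  Its open stars are therefore pulled back to an open covering, and a Lebesgue number turns the
  covering into a labeling of all points that is odd under both flips. The count is made on a fine
  subdivision of a fixed cell structure; a small alternating simplex then yields a point common to
  all sets named by its labels, so the corresponding vertices span a simplex.\<close>

type_synonym 'a chain = "'a list \<Rightarrow>\<^sub>0 int"

abbreviation support :: "'a chain \<Rightarrow> 'a list set" where
  "support \<equiv> Poly_Mapping.keys"

definition join :: "'a \<Rightarrow> 'a chain \<Rightarrow> 'a chain" where
  "join b = frag_extend (\<lambda>\<sigma>. frag_of (b # \<sigma>))"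

text \<open>The empty list is a simplex of dimension \<open>-1\<close>, so the chain complex is augmented.\<close>

primrec face_sum :: "'a list \<Rightarrow> 'a chain" where
  "face_sum [] = 0"
| "face_sum (v # \<sigma>) = frag_of \<sigma> - join v (face_sum \<sigma>)"

definition boundary :: "'a chain \<Rightarrow> 'a chain" where
  "boundary = frag_extend face_sum"

definition push :: "('a \<Rightarrow> 'b) \<Rightarrow> 'a chain \<Rightarrow> 'b chain" where
  "push f = frag_extend (\<lambda>\<sigma>. frag_of (map f \<sigma>))"

lemma join_simps [simp]:
  "join b 0 = 0" "join b (frag_of \<sigma>) = frag_of (b # \<sigma>)"
  "join b (c + d) = join b c + join b d" "join b (c - d) = join b c - join b d" "join b (- c) = - join b c"
  by (simp_all add: join_def frag_extend_add frag_extend_diff frag_extend_minus)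

lemma boundary_simps [simp]:
  "boundary 0 = 0" "boundary (frag_of \<sigma>) = face_sum \<sigma>"
  "boundary (c + d) = boundary c + boundary d" "boundary (c - d) = boundary c - boundary d"
  "boundary (- c) = - boundary c"
  by (simp_all add: boundary_def frag_extend_add frag_extend_diff frag_extend_minus)

lemma push_simps [simp]:
  "push f 0 = 0" "push f (frag_of \<sigma>) = frag_of (map f \<sigma>)"
  "push f (c + d) = push f c + push f d" "push f (c - d) = push f c - push f d" "push f (- c) = - push f c"
  by (simp_all add: push_def frag_extend_add frag_extend_diff frag_extend_minus)

lemma chain_induct [case_names zero one diff]:
  fixes c :: "'a \<Rightarrow>\<^sub>0 int"
  assumes "P 0" "\<And>\<sigma>. P (frag_of \<sigma>)" "\<And>c d. P c \<Longrightarrow> P d \<Longrightarrow> P (c - d)"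
  shows "P c"
  using subset_UNIV by (rule frag_induction) (use assms in auto)

text \<open>The cone formula needs no correction in lowest degree, because the empty simplex is the
  face of a single vertex.\<close>

lemma boundary_join: "boundary (join b c) = c - join b (boundary c)"
  by (induction c rule: chain_induct) auto

lemma boundary_face_sum: "boundary (face_sum \<sigma>) = 0"
  by (induction \<sigma>) (auto simp: boundary_join)

lemma push_join: "push f (join b c) = join (f b) (push f c)"
  by (induction c rule: chain_induct) auto

lemma push_face_sum: "push f (face_sum \<sigma>) = face_sum (map f \<sigma>)"
  by (induction \<sigma>) (auto simp: push_join)

lemma boundary_push: "boundary (push f c) = push f (boundary c)"
  by (induction c rule: chain_induct) (auto simp: push_face_sum)

lemma push_push: "push f (push g c) = push (f \<circ> g) c"
  by (induction c rule: chain_induct) (auto simp: comp_def)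

lemma push_id [simp]: "push id c = c"
  by (induction c rule: chain_induct) auto

lemma keys_join: "support (join b c) \<subseteq> (#) b ` support c"
  unfolding join_def by (rule order_trans[OF keys_frag_extend]) (auto simp: keys_frag_of)

lemma keys_push: "support (push f c) \<subseteq> map f ` support c"
  unfolding push_def by (rule order_trans[OF keys_frag_extend]) (auto simp: keys_frag_of)

lemma keys_face_sum:
  "\<tau> \<in> support (face_sum \<sigma>) \<Longrightarrow> set \<tau> \<subseteq> set \<sigma> \<and> Suc (length \<tau>) = length \<sigma>"
proof (induction \<sigma> arbitrary: \<tau>)
  case (Cons v \<sigma>)
  then have "\<tau> = \<sigma> \<or> \<tau> \<in> support (join v (face_sum \<sigma>))"
    using keys_diff[of "frag_of \<sigma>" "join v (face_sum \<sigma>)"] by auto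
  then show ?case
    using keys_join[of v "face_sum \<sigma>"] Cons.IH by fastforce
qed auto

section \<open>Barycentric subdivision and its mesh\<close>

definition barycenter :: "'a::real_vector list \<Rightarrow> 'a" where
  "barycenter \<sigma> = (1 / real (length \<sigma>)) *\<^sub>R sum_list \<sigma>"

text \<open>The number \<open>k\<close> is the recursion depth and is meant to be the length of
  \<open>\<sigma>\<close>, which makes the recursion through faces primitive. Accordingly
  \<open>Sd k\<close> is meant for chains of simplices with \<open>k\<close> vertices.\<close>

primrec subdiv :: "nat \<Rightarrow> 'a::real_vector list \<Rightarrow> 'a chain" where
  "subdiv 0 \<sigma> = frag_of \<sigma>"
| "subdiv (Suc k) \<sigma> = join (barycenter \<sigma>) (frag_extend (subdiv k) (face_sum \<sigma>))"

definition Sd :: "nat \<Rightarrow> 'a::real_vector chain \<Rightarrow> 'a chain" where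
  "Sd k = frag_extend (subdiv k)"

lemma Sd_simps [simp]:
  "Sd k 0 = 0" "Sd k (frag_of \<sigma>) = subdiv k \<sigma>"
  "Sd k (c + d) = Sd k c + Sd k d" "Sd k (c - d) = Sd k c - Sd k d" "Sd k (- c) = - Sd k c"
  by (simp_all add: Sd_def frag_extend_add frag_extend_diff frag_extend_minus)

lemma subdiv_Suc: "subdiv (Suc k) \<sigma> = join (barycenter \<sigma>) (Sd k (face_sum \<sigma>))"
  by (simp add: Sd_def)

lemma frag_extend_extend: "frag_extend f (frag_extend g c) = frag_extend (\<lambda>x. frag_extend f (g x)) c"
  by (induction c rule: chain_induct) (auto simp: frag_extend_diff)

lemma boundary_Sd_aux:
  assumes "\<And>\<sigma>. \<sigma> \<in> support c \<Longrightarrow> boundary (subdiv (Suc k) \<sigma>) = Sd k (face_sum \<sigma>)"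
  shows "boundary (Sd (Suc k) c) = Sd k (boundary c)"
  unfolding boundary_def Sd_def frag_extend_extend
  by (rule frag_extend_eq) (use assms in \<open>simp add: boundary_def Sd_def\<close>)

text \<open>Apply the cone formula. Its second term is a cone over the boundary of the subdivided
  face sum; by induction this is the subdivision of a double boundary, hence zero.\<close>

lemma boundary_subdiv:
  "length \<sigma> = Suc k \<Longrightarrow> boundary (subdiv (Suc k) \<sigma>) = Sd k (face_sum \<sigma>)"
proof (induction k arbitrary: \<sigma>)
  case 0
  then obtain v where "\<sigma> = [v]" by (cases \<sigma>) auto
  then show ?case by (simp add: boundary_join)
next
  case (Suc k)
  have "boundary (Sd (Suc k) (face_sum \<sigma>)) = Sd k (boundary (face_sum \<sigma>))"
    by (rule boundary_Sd_aux) (use Suc keys_face_sum[of _ \<sigma>] in auto)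
  then show ?case
    by (simp add: subdiv_Suc boundary_join boundary_face_sum del: subdiv.simps)
qed

lemma boundary_Sd:
  assumes "\<And>\<sigma>. \<sigma> \<in> support c \<Longrightarrow> length \<sigma> = Suc k"
  shows "boundary (Sd (Suc k) c) = Sd k (boundary c)"
  by (rule boundary_Sd_aux) (use assms boundary_subdiv in auto)

lemma barycenter_map: "linear f \<Longrightarrow> barycenter (map f \<sigma>) = f (barycenter \<sigma>)"
proof -
  assume f: "linear f"
  have "sum_list (map f \<sigma>) = f (sum_list \<sigma>)"
    by (induction \<sigma>) (auto simp: linear_0[OF f] linear_add[OF f])
  then show ?thesis by (simp add: barycenter_def linear_cmul[OF f])
qed

text \<open>Linear maps preserve barycenters. The lemma serves for \<open>flip1\<close> and
  \<open>flip2\<close>, so that subdividing the cells keeps their symmetry.\<close>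

lemma push_subdiv: "linear f \<Longrightarrow> push f (subdiv k \<sigma>) = subdiv k (map f \<sigma>)"
proof (induction k arbitrary: \<sigma>)
  case (Suc k)
  have "push f (Sd k c) = Sd k (push f c)" for c
    by (induction c rule: chain_induct) (auto simp: Suc)
  then show ?case
    by (simp add: subdiv_Suc push_join push_face_sum barycenter_map Suc.prems del: subdiv.simps)
qed auto

lemma push_Sd: "linear f \<Longrightarrow> push f (Sd k c) = Sd k (push f c)"
  by (induction c rule: chain_induct) (auto simp: push_subdiv)

text \<open>The vector \<open>barycenter \<sigma> - x\<close> is the mean of the
  \<open>k + 1\<close> differences between entries of \<open>\<sigma>\<close> and \<open>x\<close>,
  one of which vanishes.\<close>

lemma dist_barycenter:
  fixes \<sigma> :: "'a::real_normed_vector list"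
  assumes "length \<sigma> = Suc k" "x \<in> set \<sigma>" "\<And>y. y \<in> set \<sigma> \<Longrightarrow> dist x y \<le> D"
  shows "dist (barycenter \<sigma>) x \<le> real k / real (Suc k) * D"
proof -
  obtain ys zs where s: "\<sigma> = ys @ x # zs" using assms(2) by (meson split_list)
  have le: "norm (sum_list us - real (length us) *\<^sub>R x) \<le> real (length us) * D"
    if "set us \<subseteq> set \<sigma>" for us
    using that
  proof (induction us)
    case (Cons u us)
    have "sum_list (u # us) - real (length (u # us)) *\<^sub>R x = (u - x) + (sum_list us - real (length us) *\<^sub>R x)"
      by (simp add: algebra_simps)
    also have "norm \<dots> \<le> norm (u - x) + norm (sum_list us - real (length us) *\<^sub>R x)"
      by (rule norm_triangle_ineq)
    also have "\<dots> \<le> D + real (length us) * D"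
      using Cons assms(3)[of u] by (intro add_mono) (auto simp: dist_norm norm_minus_commute)
    finally show ?case by (simp add: algebra_simps)
  qed auto
  have len: "length (ys @ zs) = k" using assms(1) s by simp
  have "sum_list \<sigma> - real (Suc k) *\<^sub>R x = sum_list (ys @ zs) - real k *\<^sub>R x"
    by (simp add: s algebra_simps)
  moreover have "norm (sum_list (ys @ zs) - real (length (ys @ zs)) *\<^sub>R x) \<le> real (length (ys @ zs)) * D"
    by (rule le) (auto simp: s)
  ultimately have n: "norm (sum_list \<sigma> - real (Suc k) *\<^sub>R x) \<le> real k * D"
    unfolding len by simp
  have "barycenter \<sigma> - x = (1 / real (Suc k)) *\<^sub>R (sum_list \<sigma> - real (Suc k) *\<^sub>R x)"
    by (simp add: barycenter_def assms(1) scaleR_diff_right del: of_nat_Suc)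
  then have "dist (barycenter \<sigma>) x = (1 / real (Suc k)) * norm (sum_list \<sigma> - real (Suc k) *\<^sub>R x)"
    by (simp add: dist_norm)
  also have "\<dots> \<le> (1 / real (Suc k)) * (real k * D)"
    using n by (intro mult_left_mono) auto
  finally show ?thesis by simp
qed

lemma barycenter_in_hull: "\<sigma> \<noteq> [] \<Longrightarrow> barycenter \<sigma> \<in> convex hull (set \<sigma>)"
proof (induction \<sigma>)
  case (Cons v \<sigma>)
  show ?case
  proof (cases "\<sigma> = []")
    case True
    then show ?thesis by (simp add: barycenter_def)
  next
    case False
    define n where "n = real (length \<sigma>)"
    have n: "n > 0" using False by (simp add: n_def)
    have "barycenter \<sigma> \<in> convex hull (set (v # \<sigma>))"
      using Cons.IH[OF False] hull_mono[of "set \<sigma>" "set (v # \<sigma>)"] by auto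
    moreover have "v \<in> convex hull (set (v # \<sigma>))" by (simp add: hull_inc)
    moreover have "barycenter (v # \<sigma>) = (1 / (n + 1)) *\<^sub>R v + (n / (n + 1)) *\<^sub>R barycenter \<sigma>"
      using n by (simp add: barycenter_def n_def[symmetric] scaleR_add_right add.commute)
    ultimately show ?thesis
      using n by (auto intro!: convexD simp: field_simps convex_convex_hull)
  qed
qed auto

lemma keys_subdiv_Suc:
  assumes "\<tau> \<in> support (subdiv (Suc k) \<sigma>)"
  obtains \<rho> \<tau>' where "\<rho> \<in> support (face_sum \<sigma>)" "\<tau>' \<in> support (subdiv k \<rho>)" "\<tau> = barycenter \<sigma> # \<tau>'"
proof -
  obtain \<tau>' where t: "\<tau>' \<in> support (frag_extend (subdiv k) (face_sum \<sigma>))" "\<tau> = barycenter \<sigma> # \<tau>'"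
    using assms keys_join by fastforce
  then obtain \<rho> where "\<rho> \<in> support (face_sum \<sigma>)" "\<tau>' \<in> support (subdiv k \<rho>)"
    using keys_frag_extend[of "subdiv k" "face_sum \<sigma>"] by blast
  then show thesis using that t by blast
qed

lemma subdiv_in_hull:
  assumes "length \<sigma> = k" "\<tau> \<in> support (subdiv k \<sigma>)"
  shows "length \<tau> = k \<and> set \<tau> \<subseteq> convex hull (set \<sigma>)"
  using assms
proof (induction k arbitrary: \<sigma> \<tau>)
  case (Suc k)
  obtain \<rho> \<tau>' where r: "\<rho> \<in> support (face_sum \<sigma>)" "\<tau>' \<in> support (subdiv k \<rho>)" "\<tau> = barycenter \<sigma> # \<tau>'"
    using keys_subdiv_Suc Suc.prems by blast
  then have "length \<rho> = k" "set \<rho> \<subseteq> set \<sigma>" using keys_face_sum Suc.prems by fastforce+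
  then show ?case
    using Suc.IH[of \<rho> \<tau>'] r hull_mono[of "set \<rho>" "set \<sigma>"] barycenter_in_hull[of \<sigma>] Suc.prems by fastforce
qed auto

lemma dist_hull_le:
  fixes x :: "'a::real_normed_vector"
  assumes "y \<in> convex hull S" "\<And>z. z \<in> S \<Longrightarrow> dist x z \<le> D"
  shows "dist x y \<le> D"
proof -
  have "convex hull S \<subseteq> cball x D"
    by (rule hull_minimal) (use assms(2) in auto)
  then show ?thesis using assms(1) by auto
qed

text \<open>Two vertices of \<open>\<tau>\<close> either both come from the subdivision of a face,
  where the factor is smaller, or one is the barycenter; then \<open>dist_barycenter\<close> extends
  from the vertices of \<open>\<sigma>\<close> to their hull, as balls are convex.\<close>

lemma subdiv_mesh:
  fixes \<sigma> :: "'a::real_normed_vector list"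
  assumes "length \<sigma> = Suc k" "\<tau> \<in> support (subdiv (Suc k) \<sigma>)"
    and "\<And>x y. x \<in> set \<sigma> \<Longrightarrow> y \<in> set \<sigma> \<Longrightarrow> dist x y \<le> D"
    and "x \<in> set \<tau>" "y \<in> set \<tau>"
  shows "dist x y \<le> real k / real (Suc k) * D"
  using assms
proof (induction k arbitrary: \<sigma> \<tau> x y)
  case 0
  then obtain v where "\<sigma> = [v]" by (cases \<sigma>) auto
  with 0 show ?case by (auto simp: keys_frag_of)
next
  case (Suc k)
  have D: "D \<ge> 0" using Suc.prems(1,3) by (cases \<sigma>) (auto intro: order_trans[OF zero_le_dist])
  obtain \<rho> \<tau>' where r: "\<rho> \<in> support (face_sum \<sigma>)" "\<tau>' \<in> support (subdiv (Suc k) \<rho>)" "\<tau> = barycenter \<sigma> # \<tau>'"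
    using keys_subdiv_Suc Suc.prems by blast
  then have rho: "length \<rho> = Suc k" "set \<rho> \<subseteq> set \<sigma>" using keys_face_sum Suc.prems by fastforce+
  let ?D = "real (Suc k) / real (Suc (Suc k)) * D"
  have tt: "dist x y \<le> ?D" if "x \<in> set \<tau>'" "y \<in> set \<tau>'" for x y
  proof -
    have "dist x y \<le> real k / real (Suc k) * D"
      by (rule Suc.IH[OF rho(1) r(2)]) (use Suc.prems(3) rho that in auto)
    also have "\<dots> \<le> ?D" using D by (intro mult_right_mono) (auto simp: field_simps)
    finally show ?thesis .
  qed
  have bt: "dist (barycenter \<sigma>) y \<le> ?D" if "y \<in> set \<tau>'" for y
  proof (rule dist_hull_le)
    show "y \<in> convex hull (set \<sigma>)"
      using subdiv_in_hull[OF rho(1) r(2)] that hull_mono[OF rho(2)] by auto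
    show "dist (barycenter \<sigma>) z \<le> ?D" if "z \<in> set \<sigma>" for z
      using dist_barycenter[OF Suc.prems(1) that] Suc.prems(3)[OF that] by blast
  qed
  show ?case
  proof (cases "x = y")
    case True
    then show ?thesis using D by simp
  next
    case False
    then consider "x \<in> set \<tau>'" "y \<in> set \<tau>'" | "x = barycenter \<sigma>" "y \<in> set \<tau>'" | "y = barycenter \<sigma>" "x \<in> set \<tau>'"
      using Suc.prems(4,5) unfolding r(3) by auto
    then show ?thesis
      by cases (use tt bt in \<open>simp_all only: dist_commute\<close>)
  qed
qed

lemma keys_Sd:
  assumes "\<tau> \<in> support (Sd k c)"
  obtains \<sigma> where "\<sigma> \<in> support c" "\<tau> \<in> support (subdiv k \<sigma>)"
  using assms keys_frag_extend[of "subdiv k" c] by (auto simp: Sd_def)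

lemma keys_iterated_Sd:
  fixes c :: "'a::real_normed_vector chain"
  assumes len: "\<And>\<sigma>. \<sigma> \<in> support c \<Longrightarrow> length \<sigma> = Suc k"
    and mesh: "\<And>\<sigma> x y. \<sigma> \<in> support c \<Longrightarrow> x \<in> set \<sigma> \<Longrightarrow> y \<in> set \<sigma> \<Longrightarrow> dist x y \<le> D"
    and "\<tau> \<in> support ((Sd (Suc k) ^^ N) c)"
  shows "length \<tau> = Suc k \<and> (\<exists>\<sigma>\<in>support c. set \<tau> \<subseteq> convex hull (set \<sigma>)) \<and>
    (\<forall>x\<in>set \<tau>. \<forall>y\<in>set \<tau>. dist x y \<le> (real k / real (Suc k)) ^ N * D)"
  using assms(3)
proof (induction N arbitrary: \<tau>)
  case 0
  then have "\<tau> \<in> support c" by simp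
  then show ?case using len mesh hull_subset[of "set \<tau>" convex] by auto
next
  case (Suc N)
  then obtain \<rho> where r: "\<rho> \<in> support ((Sd (Suc k) ^^ N) c)" "\<tau> \<in> support (subdiv (Suc k) \<rho>)"
    by (auto elim: keys_Sd)
  note I = Suc.IH[OF r(1)]
  then obtain \<sigma> where s: "\<sigma>\<in>support c" "set \<rho> \<subseteq> convex hull (set \<sigma>)" by blast
  have "length \<tau> = Suc k \<and> set \<tau> \<subseteq> convex hull (set \<rho>)"
    by (rule subdiv_in_hull[OF _ r(2)]) (use I in auto)
  moreover have "convex hull (set \<rho>) \<subseteq> convex hull (set \<sigma>)"
    using s by (intro hull_minimal) auto
  moreover have "dist x y \<le> real k / real (Suc k) * ((real k / real (Suc k)) ^ N * D)" if "x \<in> set \<tau>" "y \<in> set \<tau>" for x y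
    by (rule subdiv_mesh[OF _ r(2)]) (use I that in auto)
  ultimately show ?case
    unfolding power_Suc mult.assoc using s(1) by blast
qed

lemma boundary_iterated_Sd:
  fixes c :: "'a::real_vector chain"
  assumes len: "\<And>\<sigma>. \<sigma> \<in> support c \<Longrightarrow> length \<sigma> = Suc k"
  shows "boundary ((Sd (Suc k) ^^ N) c) = (Sd k ^^ N) (boundary c)"
proof (induction N)
  case (Suc N)
  have "length \<tau> = Suc k" if "\<tau> \<in> support ((Sd (Suc k) ^^ N) c)" for \<tau>
    using that
  proof (induction N arbitrary: \<tau>)
    case (Suc N)
    then obtain \<rho> where "\<rho> \<in> support ((Sd (Suc k) ^^ N) c)" "\<tau> \<in> support (subdiv (Suc k) \<rho>)"
      by (auto elim: keys_Sd)
    then show ?case using subdiv_in_hull Suc.IH by blast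
  qed (use len in auto)
  then show ?case using Suc boundary_Sd[of "(Sd (Suc k) ^^ N) c" k] by simp
qed auto

lemma iterated_Sd_simps:
  "(Sd k ^^ N) 0 = 0"
  "(Sd k ^^ N) (c + d) = (Sd k ^^ N) c + (Sd k ^^ N) d"
  "(Sd k ^^ N) (c - d) = (Sd k ^^ N) c - (Sd k ^^ N) d"
  "(Sd k ^^ N) (- c) = - (Sd k ^^ N) c"
  by (induction N) auto

lemma push_iterated_Sd: "linear f \<Longrightarrow> push f ((Sd k ^^ N) c) = (Sd k ^^ N) (push f c)"
  by (induction N) (auto simp: push_Sd)


section \<open>Alternating simplices and the cells of a product of spheres\<close>

text \<open>The parameter \<open>s\<close> is the sign expected of the first entry. The empty list
  alternates for every \<open>s\<close>, and this is what makes the count odd at the start of the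
  recursion.\<close>

fun alternating :: "int \<Rightarrow> int list \<Rightarrow> bool" where
  "alternating s [] = True"
| "alternating s (x # xs) = (sgn x = s \<and> alternating (- s) xs)"

primrec faces :: "'a list \<Rightarrow> 'a list list" where
  "faces [] = []"
| "faces (x # xs) = xs # map ((#) x) (faces xs)"

text \<open>Fan's count. A nonempty list alternating from \<open>s\<close> has one face of that
  kind, by deleting its last entry; one alternating from \<open>- s\<close> has one, by deleting its
  first; any other list has none, or two from a pair of neighbours with equal signs. The formal
  proof reaches this parity by induction on the first entry.\<close>

lemma parity_alternating_faces:
  assumes "\<forall>x\<in>set xs. x \<noteq> 0" "s \<in> {1, -1}"
  shows "even ((\<Sum>f\<leftarrow>faces xs. of_bool (alternating s f)) + of_bool (alternating s xs)
    + of_bool (alternating (- s) xs) :: int)"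
  using assms
proof (induction xs arbitrary: s)
  case (Cons x xs)
  have IH: "even ((\<Sum>f\<leftarrow>faces xs. of_bool (alternating (- s) f)) + of_bool (alternating (- s) xs)
    + of_bool (alternating s xs) :: int)"
    using Cons.IH[of "- s"] Cons.prems by auto
  consider "sgn x = s" "sgn x \<noteq> - s" | "sgn x = - s" "sgn x \<noteq> s"
    using Cons.prems by (cases "x > 0") (auto simp: sgn_if split: if_splits)
  then show ?case
  proof cases
    case 1
    then have "(\<Sum>f\<leftarrow>faces xs. of_bool (alternating s (x # f))) =
        (\<Sum>f\<leftarrow>faces xs. of_bool (alternating (- s) f) :: int)" by simp
    then show ?thesis using IH 1 by (auto simp: comp_def)
  next
    case 2
    then have "(\<Sum>f\<leftarrow>faces xs. of_bool (alternating s (x # f))) = (0 :: int)" by simp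
    then show ?thesis using 2 by (simp add: comp_def)
  qed
qed auto

lemma set_faces: "zs \<in> set (faces xs) \<Longrightarrow> set zs \<subseteq> set xs"
  by (induction xs arbitrary: zs) fastforce+

lemma mset_faces_insort_key:
  assumes "sorted (map f ys)"
  shows "mset (faces (insort_key f x ys)) = add_mset ys (image_mset (insort_key f x) (mset (faces ys)))"
  using assms
proof (induction ys)
  case (Cons y ys)
  show ?case
  proof (cases "f x \<le> f y")
    case True
    \<comment> \<open>The key of \<open>x\<close> is at most that of every entry of a face, so
      insertion puts \<open>x\<close> in front.\<close>
    have "insort_key f x zs = x # zs" if "zs \<in> set (faces (y # ys))" for zs
    proof (cases zs)
      case (Cons z us)
      then have "z \<in> set (y # ys)" using set_faces[OF that] by auto
      then have "f x \<le> f z" using True \<open>sorted (map f (y # ys))\<close> by auto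
      then show ?thesis using Cons by simp
    qed auto
    then have "image_mset (insort_key f x) (mset (faces (y # ys))) = image_mset ((#) x) (mset (faces (y # ys)))"
      by (intro image_mset_cong) auto
    then show ?thesis using True by (simp only: insort_key.simps if_True) (simp add: multiset.map_comp)
  next
    case False
    have "image_mset (insort_key f x) (image_mset ((#) y) M) = image_mset ((#) y) (image_mset (insort_key f x) M)"
      for M using False by (induction M) auto
    then show ?thesis using False Cons by simp
  qed
qed auto

text \<open>Alternation is judged after sorting the labels, whereas faces are taken in the order of
  the vertices. As multisets the two operations commute, which is enough for counting.\<close>

lemma mset_faces_sort_key:
  "mset (map (sort_key f) (faces xs)) = mset (faces (sort_key f xs))"
proof (induction xs)
  case (Cons x xs)
  have "mset (map (sort_key f) (faces (x # xs))) =
      add_mset (sort_key f xs) (image_mset (insort_key f x) (mset (map (sort_key f) (faces xs))))"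
    by (simp add: multiset.map_comp comp_def)
  also have "\<dots> = mset (faces (sort_key f (x # xs)))"
    by (simp add: Cons mset_faces_insort_key del: mset_map)
  finally show ?case .
qed auto

lemma faces_map: "faces (map f xs) = map (map f) (faces xs)"
  by (induction xs) auto

lemma alternating_uminus: "alternating s (map uminus xs) = alternating (- s) xs"
  by (induction xs arbitrary: s) (auto simp: sgn_minus minus_equation_iff)

lemma sort_key_abs_uminus:
  "sort_key abs (map uminus xs) = map uminus (sort_key abs (xs :: int list))"
proof -
  have "insort_key abs (- x) (map uminus xs) = map uminus (insort_key abs x xs)" for x :: int and xs
    by (induction xs) auto
  then show ?thesis by (induction xs) auto
qed

definition alt_indicator :: "('a \<Rightarrow> int) \<Rightarrow> int \<Rightarrow> 'a list \<Rightarrow> int" where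
  "alt_indicator L s \<sigma> = of_bool (alternating s (sort_key abs (map L \<sigma>)))"

lemma parity_alt_indicator_faces:
  assumes "\<forall>x\<in>set \<sigma>. L x \<noteq> 0" "s \<in> {1, -1}"
  shows "even ((\<Sum>f\<leftarrow>faces \<sigma>. alt_indicator L s f) + alt_indicator L s \<sigma> + alt_indicator L (- s) \<sigma>)"
proof -
  let ?xs = "map L \<sigma>"
  have "(\<Sum>f\<leftarrow>faces \<sigma>. alt_indicator L s f) =
      sum_mset (image_mset (\<lambda>x. of_bool (alternating s x)) (mset (map (sort_key abs) (faces ?xs))))"
    by (simp add: faces_map alt_indicator_def sum_mset_sum_list[symmetric] multiset.map_comp comp_def)
  also have "\<dots> = (\<Sum>f\<leftarrow>faces (sort_key abs ?xs). of_bool (alternating s f))"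
    unfolding mset_faces_sort_key by (metis mset_map sum_mset_sum_list)
  finally show ?thesis
    using parity_alternating_faces[of "sort_key abs ?xs" s] assms by (simp add: alt_indicator_def)
qed

text \<open>The evaluation of the cochain \<open>\<phi>\<close> on the chain
  \<open>c\<close>.\<close>

definition weight :: "('a list \<Rightarrow> int) \<Rightarrow> 'a chain \<Rightarrow> int" where
  "weight \<phi> c = (\<Sum>\<sigma>\<in>support c. Poly_Mapping.lookup c \<sigma> * \<phi> \<sigma>)"

lemma weight_superset:
  assumes "finite A" "support c \<subseteq> A"
  shows "weight \<phi> c = (\<Sum>\<sigma>\<in>A. Poly_Mapping.lookup c \<sigma> * \<phi> \<sigma>)"
  unfolding weight_def by (rule sum.mono_neutral_left) (use assms in \<open>auto simp: in_keys_iff\<close>)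

lemma weight_simps [simp]:
  "weight \<phi> 0 = 0" "weight \<phi> (frag_of \<sigma>) = \<phi> \<sigma>"
  "weight \<phi> (c + d) = weight \<phi> c + weight \<phi> d" "weight \<phi> (c - d) = weight \<phi> c - weight \<phi> d"
  "weight \<phi> (- c) = - weight \<phi> c"
proof -
  let ?A = "support c \<union> support d"
  have A: "finite ?A" by simp
  have "support (c + d) \<subseteq> ?A" "support (c - d) \<subseteq> ?A" "support c \<subseteq> ?A" "support d \<subseteq> ?A"
    by (auto simp: keys_add keys_diff in_mono intro: Poly_Mapping.keys_add[THEN subsetD])
  note W = this[THEN weight_superset[OF A]]
  show "weight \<phi> (c + d) = weight \<phi> c + weight \<phi> d" "weight \<phi> (c - d) = weight \<phi> c - weight \<phi> d"
    unfolding W by (simp_all add: lookup_add lookup_minus algebra_simps sum.distrib sum_subtractf)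
qed (auto simp: weight_def sum_negf)

lemma weight_join: "weight \<phi> (join v c) = weight (\<lambda>\<sigma>. \<phi> (v # \<sigma>)) c"
  by (induction c rule: chain_induct) auto

lemma weight_push: "weight \<phi> (push f c) = weight (\<lambda>\<sigma>. \<phi> (map f \<sigma>)) c"
  by (induction c rule: chain_induct) auto

lemma weight_boundary: "weight \<phi> (boundary c) = weight (\<lambda>\<sigma>. weight \<phi> (face_sum \<sigma>)) c"
  by (induction c rule: chain_induct) auto

lemma weight_face_sum: "even (weight \<phi> (face_sum \<sigma>) - (\<Sum>f\<leftarrow>faces \<sigma>. \<phi> f))"
proof (induction \<sigma> arbitrary: \<phi>)
  case (Cons v \<sigma>)
  show ?case using Cons[of "\<lambda>\<sigma>. \<phi> (v # \<sigma>)"] by (simp add: weight_join comp_def)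
qed auto

lemma weight_cong_mod2:
  assumes "\<And>\<sigma>. \<sigma> \<in> support c \<Longrightarrow> even (\<phi> \<sigma> - \<psi> \<sigma>)"
  shows "even (weight \<phi> c - weight \<psi> c)"
proof -
  have "weight \<phi> c - weight \<psi> c = (\<Sum>\<sigma>\<in>support c. Poly_Mapping.lookup c \<sigma> * (\<phi> \<sigma> - \<psi> \<sigma>))"
    by (simp add: weight_def sum_subtractf algebra_simps)
  also have "even \<dots>" using assms by (intro dvd_sum) auto
  finally show ?thesis .
qed

lemma weight_add_fun: "weight (\<lambda>\<sigma>. \<phi> \<sigma> + \<psi> \<sigma>) c = weight \<phi> c + weight \<psi> c"
  by (simp add: weight_def sum.distrib algebra_simps)

text \<open>Fan's count for chains: modulo 2, where the signs of faces disappear, the coboundary of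
  one indicator is the sum of both.\<close>

lemma weight_alt_indicator_boundary:
  assumes "\<And>\<sigma> x. \<sigma> \<in> support c \<Longrightarrow> x \<in> set \<sigma> \<Longrightarrow> L x \<noteq> 0" "s \<in> {1, -1}"
  shows "even (weight (alt_indicator L s) (boundary c) -
    (weight (alt_indicator L s) c + weight (alt_indicator L (- s)) c))"
  unfolding weight_boundary weight_add_fun[symmetric]
proof (rule weight_cong_mod2)
  fix \<sigma> assume "\<sigma> \<in> support c"
  then show "even (weight (alt_indicator L s) (face_sum \<sigma>) - (alt_indicator L s \<sigma> + alt_indicator L (- s) \<sigma>))"
    using weight_face_sum[of "alt_indicator L s" \<sigma>] parity_alt_indicator_faces[of \<sigma> L s] assms by auto
qed

lemma weight_alt_indicator_push:
  assumes "\<And>\<sigma> x. \<sigma> \<in> support c \<Longrightarrow> x \<in> set \<sigma> \<Longrightarrow> L (f x) = - L x"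
  shows "weight (alt_indicator L s) (push f c) = weight (alt_indicator L (- s)) c"
  unfolding weight_push unfolding weight_def
proof (rule sum.cong[OF refl])
  fix \<sigma> assume "\<sigma> \<in> support c"
  then have "map L (map f \<sigma>) = map uminus (map L \<sigma>)" using assms by auto
  then show "Poly_Mapping.lookup c \<sigma> * alt_indicator L s (map f \<sigma>) =
      Poly_Mapping.lookup c \<sigma> * alt_indicator L (- s) \<sigma>" unfolding alt_indicator_def by (simp only: sort_key_abs_uminus alternating_uminus)
qed

section \<open>The two sign changes and the cells of a product of spheres\<close>

definition flip1 :: "'a::uminus \<times> 'b \<Rightarrow> 'a \<times> 'b" where "flip1 p = (- fst p, snd p)"
definition flip2 :: "'a \<times> 'b::uminus \<Rightarrow> 'a \<times> 'b" where "flip2 p = (fst p, - snd p)"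

definition sgn_chain :: "nat \<Rightarrow> 'a chain \<Rightarrow> 'a chain" where
  "sgn_chain i c = (if even i then c else - c)"

text \<open>Indices are shifted by one: \<open>cell b (Suc i) (Suc j)\<close> is the product of the hemispheres of
  dimensions \<open>i\<close> and \<open>j\<close> around \<open>b i\<close> and \<open>b j\<close>, whose boundary consists of the two halves of the
  equator in either factor. It is the cone over this boundary; for \<open>i = j = 0\<close> this is the cone over
  the empty simplex.\<close>

fun cell :: "(nat \<Rightarrow> 'a::real_vector) \<Rightarrow> nat \<Rightarrow> nat \<Rightarrow> ('a \<times> 'a) chain" where
  "cell b 0 j = 0"
| "cell b (Suc i) 0 = 0"
| "cell b (Suc i) (Suc j) = join (b i, b j)
     ((cell b i (Suc j) + sgn_chain i (push flip1 (cell b i (Suc j))))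
      + sgn_chain i (cell b (Suc i) j + sgn_chain j (push flip2 (cell b (Suc i) j)))
      + (if i = 0 \<and> j = 0 then frag_of [] else 0))"

definition cell_boundary :: "(nat \<Rightarrow> 'a::real_vector) \<Rightarrow> nat \<Rightarrow> nat \<Rightarrow> ('a \<times> 'a) chain" where
  "cell_boundary b i j = (cell b i (Suc j) + sgn_chain i (push flip1 (cell b i (Suc j))))
      + sgn_chain i (cell b (Suc i) j + sgn_chain j (push flip2 (cell b (Suc i) j)))
      + (if i = 0 \<and> j = 0 then frag_of [] else 0)"

declare cell.simps(3) [simp del]

lemma cell_Suc_Suc: "cell b (Suc i) (Suc j) = join (b i, b j) (cell_boundary b i j)"
  by (simp add: cell.simps(3) cell_boundary_def)

lemma push_flips [simp]:
  "push flip1 (push flip1 c) = (c :: ('a::real_vector \<times> 'b::real_vector) chain)"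
  "push flip2 (push flip2 c) = c"
  "push flip2 (push flip1 c) = push flip1 (push flip2 c)"
proof -
  have "flip1 \<circ> flip1 = (id :: 'a \<times> 'b \<Rightarrow> _)" "flip2 \<circ> flip2 = (id :: 'a \<times> 'b \<Rightarrow> _)"
    "flip2 \<circ> flip1 = (flip1 \<circ> flip2 :: 'a \<times> 'b \<Rightarrow> _)"
    by (auto simp: flip1_def flip2_def)
  then show "push flip1 (push flip1 c) = c" "push flip2 (push flip2 c) = c"
    "push flip2 (push flip1 c) = push flip1 (push flip2 c)"
    unfolding push_push by simp_all
qed

text \<open>Write T for \<open>push flip1\<close>. Consecutive dimensions contribute
  \<open>1 + (-1)^i T\<close> and \<open>1 - (-1)^i T\<close>, whose product \<open>1 - T^2\<close>
  is zero; likewise for \<open>flip2\<close>. The mixed terms cancel by the sign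
  \<open>(-1)^i\<close> in front of the second summand.\<close>

lemma boundary_cell_boundary: "boundary (cell_boundary b i j) = 0"
proof (induction "i + j" arbitrary: i j rule: less_induct)
  case less
  have IH: "boundary (cell b (Suc i') (Suc j')) = cell_boundary b i' j'" if "i' + j' < i + j" for i' j'
    unfolding cell_Suc_Suc boundary_join using less[OF that] by simp
  show ?case
  proof (cases i; cases j)
    fix i' assume "i = Suc i'" "j = 0"
    then show ?thesis using IH[of i' 0]
      by (simp add: cell_boundary_def[of b i j] boundary_push)
        (auto simp: cell_boundary_def sgn_chain_def boundary_push)
  next
    fix j' assume "i = 0" "j = Suc j'"
    then show ?thesis using IH[of 0 j']
      by (simp add: cell_boundary_def[of b i j] boundary_push)
        (auto simp: cell_boundary_def sgn_chain_def boundary_push)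
  next
    fix i' j' assume ij: "i = Suc i'" "j = Suc j'"
    then have "boundary (cell b (Suc i') (Suc j)) = cell_boundary b i' j"
       "boundary (cell b (Suc i) (Suc j')) = cell_boundary b i j'" using IH by simp_all
    then show ?thesis unfolding ij
      by (cases "even i'"; cases "even j'")
       (simp_all add: cell_boundary_def sgn_chain_def boundary_push)
  qed (simp add: cell_boundary_def sgn_chain_def)
qed

lemma boundary_cell: "boundary (cell b (Suc i) (Suc j)) = cell_boundary b i j"
  unfolding cell_Suc_Suc boundary_join by (simp add: boundary_cell_boundary)

text \<open>If the coefficient were odd, then \<open>2 ^ m\<close>, which divides its product with
  \<open>k\<close>, would divide the smaller positive number \<open>k\<close>.\<close>

lemma even_binomial_two_power:
  assumes "0 < k" "k < 2 ^ m"
  shows "even (2 ^ m choose k)"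
proof (rule ccontr)
  assume "odd (2 ^ m choose k)"
  then have "coprime (2 ^ m) (2 ^ m choose k)" by simp
  moreover have "k * (2 ^ m choose k) = 2 ^ m * ((2 ^ m - 1) choose (k - 1))"
    using assms by (metis times_binomial_minus1_eq)
  then have "2 ^ m dvd k * (2 ^ m choose k)" by simp
  ultimately have "2 ^ m dvd k" using coprime_dvd_mult_left_iff by blast
  then show False using assms by (auto dest: dvd_imp_le)
qed

text \<open>Neighbours in row \<open>2 ^ m - 1\<close> of Pascal's triangle add up to an even entry
  of the next row, so all have the parity of the initial 1.\<close>

lemma odd_binomial_two_power_minus_1:
  "k < 2 ^ m \<Longrightarrow> odd ((2 ^ m - 1) choose k)"
proof (induction k)
  case (Suc k)
  have "(2 ^ m :: nat) choose Suc k = ((2 ^ m - 1) choose k) + ((2 ^ m - 1) choose Suc k)"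
    by (subst binomial_Suc_Suc[symmetric]) simp
  then show ?case using Suc even_binomial_two_power[of "Suc k" m] by auto
qed auto

lemma support_cell_boundary:
  "support (cell_boundary b i j) \<subseteq> support (cell b i (Suc j)) \<union> support (push flip1 (cell b i (Suc j))) \<union>
     support (cell b (Suc i) j) \<union> support (push flip2 (cell b (Suc i) j)) \<union> (if i = 0 \<and> j = 0 then {[]} else {})"
proof -
  have sg: "support (sgn_chain k c) = support c" for k and c :: "'x chain"
    by (simp add: sgn_chain_def)
  have add: "support (c + d) \<subseteq> A \<union> B" if "support c \<subseteq> A" "support d \<subseteq> B" for A B and c d :: "'x chain"
    using keys_add[of c d] that by blast
  have "support (cell_boundary b i j) \<subseteq> (support (cell b i (Suc j)) \<union> support (push flip1 (cell b i (Suc j)))) \<union>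
     (support (cell b (Suc i) j) \<union> support (push flip2 (cell b (Suc i) j))) \<union> (if i = 0 \<and> j = 0 then {[]} else {})"
    unfolding cell_boundary_def by (intro add) (simp_all add: sg keys_frag_of add)
  then show ?thesis by blast
qed

lemma length_cell: "\<sigma> \<in> support (cell b i j) \<Longrightarrow> Suc (length \<sigma>) = i + j"
proof (induction b i j arbitrary: \<sigma> rule: cell.induct)
  case (3 b i j)
  obtain \<tau> where t: "\<sigma> = (b i, b j) # \<tau>" "\<tau> \<in> support (cell_boundary b i j)"
    using "3.prems" keys_join[of "(b i, b j)" "cell_boundary b i j"] by (auto simp: cell_Suc_Suc)
  have "\<tau> \<in> support (cell b i (Suc j)) \<union> support (push flip1 (cell b i (Suc j))) \<union>
     support (cell b (Suc i) j) \<union> support (push flip2 (cell b (Suc i) j)) \<union> (if i = 0 \<and> j = 0 then {[]} else {})"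
    using support_cell_boundary t(2) by blast
  moreover have "Suc (length \<rho>) = i + Suc j"
    if "\<rho> \<in> support (cell b i (Suc j)) \<union> support (push flip1 (cell b i (Suc j)))" for \<rho>
    using that keys_push[of flip1 "cell b i (Suc j)"] "3.IH"(1) by auto
  moreover have "Suc (length \<rho>) = Suc i + j"
    if "\<rho> \<in> support (cell b (Suc i) j) \<union> support (push flip2 (cell b (Suc i) j))" for \<rho>
    using that keys_push[of flip2 "cell b (Suc i) j"] "3.IH" by auto
  ultimately have "Suc (length \<tau>) = i + Suc j" by (auto split: if_splits)
  then show ?case using t(1) by simp
qed auto

definition octahedral_sphere :: "'a::euclidean_space set" where
  "octahedral_sphere = {x. (\<Sum>i\<in>Basis. \<bar>x \<bullet> i\<bar>) = 1}"

context
  fixes b :: "nat \<Rightarrow> 'a::euclidean_space" and m :: nat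
  assumes b: "bij_betw b {..<m} Basis"
begin

text \<open>The cells are built inside the unit sphere of the \<open>\<ell>\<^sup>1\<close>-norm, since there the
  segment from \<open>b i\<close> to a point whose \<open>b i\<close>-coordinate is nonnegative stays in the sphere.\<close>

definition hemisphere :: "nat \<Rightarrow> 'a set" where
  "hemisphere i = {x. 0 \<le> x \<bullet> b i \<and> (\<forall>l. i < l \<and> l < m \<longrightarrow> x \<bullet> b l = 0) \<and> (\<Sum>l<m. \<bar>x \<bullet> b l\<bar>) = 1}"

lemma inner_b: "i < m \<Longrightarrow> l < m \<Longrightarrow> b i \<bullet> b l = (if i = l then 1 else 0)"
  using b inj_on_eq_iff[of b "{..<m}" i l] bij_betwE[OF b] by (auto simp: bij_betw_def inner_Basis)

lemma b_in_hemisphere: "i < m \<Longrightarrow> b i \<in> hemisphere i"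
proof -
  assume i: "i < m"
  have "(\<Sum>l<m. \<bar>b i \<bullet> b l\<bar>) = (\<Sum>l<m. if l = i then 1 else 0)"
    by (rule sum.cong) (use i in \<open>auto simp: inner_b\<close>)
  then show ?thesis using i by (simp add: hemisphere_def inner_b)
qed

lemma segment_in_hemisphere:
  assumes "i < m" "x \<in> hemisphere i" "0 \<le> u" "0 \<le> v" "u + v = 1"
  shows "u *\<^sub>R b i + v *\<^sub>R x \<in> hemisphere i"
proof -
  have "\<bar>(u *\<^sub>R b i + v *\<^sub>R x) \<bullet> b l\<bar> = (if l = i then u else 0) + v * \<bar>x \<bullet> b l\<bar>" if "l < m" for l
    using assms that by (auto simp: inner_add_left inner_b hemisphere_def abs_mult)
  then have "(\<Sum>l<m. \<bar>(u *\<^sub>R b i + v *\<^sub>R x) \<bullet> b l\<bar>) = (\<Sum>l<m. (if l = i then u else 0) + v * \<bar>x \<bullet> b l\<bar>)"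
    by (intro sum.cong) auto
  also have "\<dots> = u + v * (\<Sum>l<m. \<bar>x \<bullet> b l\<bar>)"
    using assms(1) by (simp add: sum.distrib sum_distrib_left)
  also have "\<dots> = 1" using assms by (simp add: hemisphere_def)
  finally show ?thesis
    using assms by (auto simp: hemisphere_def inner_add_left inner_b)
qed

text \<open>Points of \<open>hemisphere i\<close> have coordinate zero along
  \<open>b (Suc i)\<close>, so they and their negatives lie on the equator of the next
  hemisphere.\<close>

lemma hemisphere_Suc:
  assumes "Suc i < m" "x \<in> hemisphere i"
  shows "x \<in> hemisphere (Suc i)" "- x \<in> hemisphere (Suc i)"
  using assms by (auto simp: hemisphere_def)

text \<open>The chain under the cone consists of lower cells and their reflections, which lie over
  equators by \<open>hemisphere_Suc\<close>. Coning at \<open>(b i, b j)\<close> moves each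
  coordinate along a segment covered by \<open>segment_in_hemisphere\<close>.\<close>

lemma cell_in_hemispheres:
  assumes "\<sigma> \<in> support (cell b (Suc i) (Suc j))" "i < m" "j < m"
  shows "convex hull (set \<sigma>) \<subseteq> hemisphere i \<times> hemisphere j"
  using assms
proof (induction "i + j" arbitrary: i j \<sigma> rule: less_induct)
  case less
  note ij = less.prems(2,3)
  obtain \<tau> where t: "\<sigma> = (b i, b j) # \<tau>" "\<tau> \<in> support (cell_boundary b i j)"
    using less.prems(1) keys_join[of "(b i, b j)" "cell_boundary b i j"] by (auto simp: cell_Suc_Suc)
  have "\<tau> \<in> support (cell b i (Suc j)) \<union> support (push flip1 (cell b i (Suc j))) \<union>
     support (cell b (Suc i) j) \<union> support (push flip2 (cell b (Suc i) j)) \<union> (if i = 0 \<and> j = 0 then {[]} else {})"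
    using support_cell_boundary t(2) by blast
  then consider (nil) "\<tau> = []" | (1) "\<tau> \<in> support (cell b i (Suc j)) \<union> support (push flip1 (cell b i (Suc j)))"
    | (2) "\<tau> \<in> support (cell b (Suc i) j) \<union> support (push flip2 (cell b (Suc i) j))"
    by (auto split: if_splits)
  then have \<tau>: "convex hull (set \<tau>) \<subseteq> hemisphere i \<times> hemisphere j"
  proof cases
    case 1
    then have "i \<noteq> 0" using keys_push[of flip1 "cell b 0 (Suc j)"] by (cases "i = 0") auto
    then obtain i' where i: "i = Suc i'" using not0_implies_Suc by blast
    have hemi: "x \<in> hemisphere i" "- x \<in> hemisphere i" if "x \<in> hemisphere i'" for x
      using hemisphere_Suc[of i' x] that ij i by auto
    have IH: "convex hull (set \<rho>) \<subseteq> hemisphere i' \<times> hemisphere j" if "\<rho> \<in> support (cell b i (Suc j))" for \<rho>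
      by (rule less.hyps) (use that i ij in auto)
    have lin: "linear (flip1 :: 'a \<times> 'a \<Rightarrow> _)"
      by (auto intro!: linearI simp: flip1_def)
    obtain \<rho> where r: "\<rho> \<in> support (cell b i (Suc j))" "\<tau> = \<rho> \<or> \<tau> = map flip1 \<rho>"
      using 1 keys_push[of flip1 "cell b i (Suc j)"] by auto
    have "q \<in> hemisphere i \<times> hemisphere j \<and> flip1 q \<in> hemisphere i \<times> hemisphere j" if "q \<in> convex hull (set \<rho>)" for q
      using subsetD[OF IH[OF r(1)] that] hemi by (auto simp: flip1_def mem_Times_iff)
    then have img: "convex hull (set \<rho>) \<subseteq> hemisphere i \<times> hemisphere j"
      "flip1 ` (convex hull (set \<rho>)) \<subseteq> hemisphere i \<times> hemisphere j" by blast+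
    have "convex hull (set \<tau>) = convex hull (set \<rho>) \<or> convex hull (set \<tau>) = flip1 ` (convex hull (set \<rho>))"
      using r convex_hull_linear_image[OF lin, of "set \<rho>"] by auto
    then show ?thesis
      using img by metis
  next
    case 2
    then have "j \<noteq> 0" using keys_push[of flip2 "cell b (Suc i) 0"] by (cases "j = 0") auto
    then obtain j' where j: "j = Suc j'" using not0_implies_Suc by blast
    have hemi: "x \<in> hemisphere j" "- x \<in> hemisphere j" if "x \<in> hemisphere j'" for x
      using hemisphere_Suc[of j' x] that ij j by auto
    have IH: "convex hull (set \<rho>) \<subseteq> hemisphere i \<times> hemisphere j'" if "\<rho> \<in> support (cell b (Suc i) j)" for \<rho>
      by (rule less.hyps) (use that j ij in auto)
    have lin: "linear (flip2 :: 'a \<times> 'a \<Rightarrow> _)"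
      by (auto intro!: linearI simp: flip2_def)
    obtain \<rho> where r: "\<rho> \<in> support (cell b (Suc i) j)" "\<tau> = \<rho> \<or> \<tau> = map flip2 \<rho>"
      using 2 keys_push[of flip2 "cell b (Suc i) j"] by auto
    have "q \<in> hemisphere i \<times> hemisphere j \<and> flip2 q \<in> hemisphere i \<times> hemisphere j" if "q \<in> convex hull (set \<rho>)" for q
      using subsetD[OF IH[OF r(1)] that] hemi by (auto simp: flip2_def mem_Times_iff)
    then have img: "convex hull (set \<rho>) \<subseteq> hemisphere i \<times> hemisphere j"
      "flip2 ` (convex hull (set \<rho>)) \<subseteq> hemisphere i \<times> hemisphere j" by blast+
    have "convex hull (set \<tau>) = convex hull (set \<rho>) \<or> convex hull (set \<tau>) = flip2 ` (convex hull (set \<rho>))"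
      using r convex_hull_linear_image[OF lin, of "set \<rho>"] by auto
    then show ?thesis
      using img by metis
  qed auto
  show ?case
  proof (cases "\<tau> = []")
    case True
    then show ?thesis using t(1) ij b_in_hemisphere by simp
  next
    case False
    show ?thesis
    proof
      fix p assume "p \<in> convex hull (set \<sigma>)"
      then obtain u v q where uv: "0 \<le> u" "0 \<le> v" "u + v = 1" and q: "q \<in> convex hull (set \<tau>)"
        and p: "p = u *\<^sub>R (b i, b j) + v *\<^sub>R q"
        using False by (auto simp: t(1) convex_hull_insert)
      have "fst q \<in> hemisphere i" "snd q \<in> hemisphere j" using \<tau> q by auto
      then have "u *\<^sub>R b i + v *\<^sub>R fst q \<in> hemisphere i" "u *\<^sub>R b j + v *\<^sub>R snd q \<in> hemisphere j"
        using segment_in_hemisphere ij uv by auto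
      then show "p \<in> hemisphere i \<times> hemisphere j" by (simp add: p mem_Times_iff)
    qed
  qed
qed

lemma hemisphere_subset: "hemisphere i \<subseteq> octahedral_sphere"
proof -
  have "(\<Sum>i\<in>Basis. \<bar>x \<bullet> i\<bar>) = (\<Sum>l<m. \<bar>x \<bullet> b l\<bar>)" for x :: 'a
    using sum.reindex_bij_betw[OF b, of "\<lambda>i. \<bar>x \<bullet> i\<bar>"] by simp
  then show ?thesis by (auto simp: hemisphere_def octahedral_sphere_def)
qed

end

lemma compact_octahedral_sphere: "compact (octahedral_sphere :: 'a::euclidean_space set)"
proof -
  have "norm x \<le> 1" if "x \<in> octahedral_sphere" for x :: 'a
    using norm_le_l1[of x] that by (simp add: octahedral_sphere_def)
  then have "bounded (octahedral_sphere :: 'a set)" by (auto intro: boundedI)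
  moreover have "closed (octahedral_sphere :: 'a set)"
    unfolding octahedral_sphere_def by (intro closed_Collect_eq continuous_intros)
  ultimately show ?thesis by (simp add: compact_eq_bounded_closed)
qed

lemma iterated_Sd_0: "(Sd 0 ^^ N) c = c"
proof -
  have "Sd 0 c = c" for c :: "'a::real_vector chain"
    by (induction c rule: chain_induct) auto
  then show ?thesis by (induction N) auto
qed

text \<open>The labeling is a function of points rather than of the vertices of one complex, so it
  can be evaluated on subdivisions of any fineness. Oddness under both flips drives the
  count.\<close>

theorem fan_product_of_spheres:
  fixes L :: "'a::euclidean_space \<times> 'a \<Rightarrow> int"
  defines "X \<equiv> octahedral_sphere \<times> octahedral_sphere"
  assumes L0: "\<And>p. p \<in> X \<Longrightarrow> L p \<noteq> 0"
    and L1: "\<And>p. p \<in> X \<Longrightarrow> L (flip1 p) = - L p"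
    and L2: "\<And>p. p \<in> X \<Longrightarrow> L (flip2 p) = - L p"
    and "i < DIM('a)" "j < DIM('a)" "odd ((i + j) choose i)" "\<delta> > 0"
  obtains \<tau> s where "length \<tau> = Suc (i + j)" "set \<tau> \<subseteq> X"
    "\<And>p q. p \<in> set \<tau> \<Longrightarrow> q \<in> set \<tau> \<Longrightarrow> dist p q < \<delta>" "alternating s (sort_key abs (map L \<tau>))"
proof -
  obtain b :: "nat \<Rightarrow> 'a" where b: "bij_betw b {..<DIM('a)} Basis"
    using ex_bij_betw_nat_finite[of "Basis :: 'a set"] by (auto simp: atLeast0LessThan)
  define m where "m = DIM('a)"
  have "bounded X"
    unfolding X_def by (intro compact_imp_bounded compact_Times compact_octahedral_sphere)
  then obtain D where D: "\<And>p q. p \<in> X \<Longrightarrow> q \<in> X \<Longrightarrow> dist p q \<le> D"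
    using bounded_two_points[of X] by blast
  define D' where "D' = max D 1"
  have D': "\<And>p q. p \<in> X \<Longrightarrow> q \<in> X \<Longrightarrow> dist p q \<le> D'" "D' > 0" using D by (fastforce simp: D'_def)+
  have "(\<lambda>N. (real (i + j) / real (Suc (i + j))) ^ N * D') \<longlonglongrightarrow> 0 * D'"
    by (intro tendsto_mult LIMSEQ_power_zero tendsto_const) auto
  then have "eventually (\<lambda>N. (real (i + j) / real (Suc (i + j))) ^ N * D' < \<delta>) sequentially"
    by (rule order_tendstoD(2)) (use \<open>\<delta> > 0\<close> in simp)
  then obtain N where N: "(real (i + j) / real (Suc (i + j))) ^ N * D' < \<delta>"
    by (auto simp: eventually_sequentially)
  \<comment> \<open>Because of the shifted indices, simplices of \<open>cell b i j\<close> have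
    \<open>i + j - 1\<close> vertices, which is the matching parameter of \<open>Sd\<close>.\<close>
  define F where "F i j = (Sd (i + j - 1) ^^ N) (cell b i j)" for i j
  have supp: "length \<tau> = Suc (i + j)" "set \<tau> \<subseteq> X"
    "\<And>p q. p \<in> set \<tau> \<Longrightarrow> q \<in> set \<tau> \<Longrightarrow> dist p q \<le> (real (i + j) / real (Suc (i + j))) ^ N * D'"
    if "\<tau> \<in> support (F (Suc i) (Suc j))" "i < m" "j < m" for i j \<tau>
  proof -
    have hull: "convex hull (set \<sigma>) \<subseteq> X" if "\<sigma> \<in> support (cell b (Suc i) (Suc j))" for \<sigma>
      using cell_in_hemispheres[OF b that] \<open>i < m\<close> \<open>j < m\<close> hemisphere_subset[OF b]
      unfolding X_def m_def by blast
    have "length \<tau> = Suc (i + j) \<and> (\<exists>\<sigma>\<in>support (cell b (Suc i) (Suc j)). set \<tau> \<subseteq> convex hull (set \<sigma>)) \<and>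
      (\<forall>x\<in>set \<tau>. \<forall>y\<in>set \<tau>. dist x y \<le> (real (i + j) / real (Suc (i + j))) ^ N * D')"
    proof (rule keys_iterated_Sd)
      show "\<tau> \<in> support ((Sd (Suc (i + j)) ^^ N) (cell b (Suc i) (Suc j)))"
        using that by (simp add: F_def)
      show "length \<sigma> = Suc (i + j)" if "\<sigma> \<in> support (cell b (Suc i) (Suc j))" for \<sigma>
        using length_cell[OF that] by simp
      show "dist x y \<le> D'" if "\<sigma> \<in> support (cell b (Suc i) (Suc j))" "x \<in> set \<sigma>" "y \<in> set \<sigma>" for \<sigma> x y
        using hull[OF that(1)] that(2,3) hull_subset[of "set \<sigma>" convex] by (intro D') auto
    qed
    then show "length \<tau> = Suc (i + j)" "set \<tau> \<subseteq> X"
      "\<And>p q. p \<in> set \<tau> \<Longrightarrow> q \<in> set \<tau> \<Longrightarrow> dist p q \<le> (real (i + j) / real (Suc (i + j))) ^ N * D'"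
      using hull by blast+
  qed
  have F0: "F 0 j = 0" "F i 0 = 0" for i j
    by (cases i; simp add: F_def iterated_Sd_simps)+
  have supp': "set \<tau> \<subseteq> X" if "\<tau> \<in> support (F i j)" "i \<le> m" "j \<le> m" for i j \<tau>
    using that supp by (cases i; cases j) (auto simp: F0)
  have lin: "linear (flip1 :: 'a \<times> 'a \<Rightarrow> _)" "linear (flip2 :: 'a \<times> 'a \<Rightarrow> _)"
    by (auto intro!: linearI simp: flip1_def flip2_def)
  have sg: "(Sd k ^^ N) (sgn_chain l c) = sgn_chain l ((Sd k ^^ N) c)" for k l and c :: "('a \<times> 'a) chain"
    by (simp add: sgn_chain_def iterated_Sd_simps)
  have bdF: "boundary (F (Suc i) (Suc j)) = (F i (Suc j) + sgn_chain i (push flip1 (F i (Suc j))))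
      + sgn_chain i (F (Suc i) j + sgn_chain j (push flip2 (F (Suc i) j)))
      + (if i = 0 \<and> j = 0 then frag_of [] else 0)" for i j
  proof -
    have "boundary (F (Suc i) (Suc j)) = (Sd (i + j) ^^ N) (cell_boundary b i j)"
      unfolding F_def using boundary_iterated_Sd[of "cell b (Suc i) (Suc j)" "i + j" N] length_cell[of _ b "Suc i" "Suc j"]
      by (simp add: boundary_cell)
    then show ?thesis
      by (simp add: cell_boundary_def iterated_Sd_simps sg F_def push_iterated_Sd lin iterated_Sd_0)
  qed
  define \<phi> where "\<phi> = alt_indicator L 1"
  define \<psi> where "\<psi> = alt_indicator L (- 1)"
  \<comment> \<open>Modulo 2 this counts, with multiplicity, the alternating simplices of either
    initial sign.\<close>
  define W where "W i j = weight \<phi> (F i j) + weight \<psi> (F i j)" for i j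
  have wsg: "even (weight f (sgn_chain l c) - weight f c)" for f l and c :: "('a \<times> 'a) chain"
    by (simp add: sgn_chain_def)
  have W_rec: "even (W (Suc i) (Suc j) - (W i (Suc j) + W (Suc i) j + of_bool (i = 0 \<and> j = 0)))"
    if "i < m" "j < m" for i j
  proof -
    have le: "i \<le> m" "Suc i \<le> m" "j \<le> m" "Suc j \<le> m" using that by auto
    \<comment> \<open>Modulo 2, \<open>W\<close> is the \<open>\<phi>\<close>-weight of the
      boundary. A flip exchanges \<open>\<phi>\<close> and \<open>\<psi>\<close>, so the two halves
      of an equator together contribute the value of \<open>W\<close> at one half; the empty simplex
      contributes the 1 in the corner.\<close>
    have "even (weight \<phi> (boundary (F (Suc i) (Suc j))) - W (Suc i) (Suc j))"
      unfolding \<phi>_def \<psi>_def W_def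
      by (rule weight_alt_indicator_boundary) (use supp(2)[OF _ that] L0 in blast, simp)
    moreover have "weight \<phi> (push flip1 (F i (Suc j))) = weight \<psi> (F i (Suc j))"
      unfolding \<phi>_def \<psi>_def
      by (rule weight_alt_indicator_push) (use supp'[of _ i "Suc j", OF _ le(1,4)] L1 in blast)
    moreover have "weight \<phi> (push flip2 (F (Suc i) j)) = weight \<psi> (F (Suc i) j)"
      unfolding \<phi>_def \<psi>_def
      by (rule weight_alt_indicator_push) (use supp'[of _ "Suc i" j, OF _ le(2,3)] L2 in blast)
    moreover have "\<phi> [] = 1" by (simp add: \<phi>_def alt_indicator_def)
    ultimately show ?thesis
      unfolding bdF using wsg[of \<phi> i "push flip1 (F i (Suc j))"]
        wsg[of \<phi> i "F (Suc i) j + sgn_chain j (push flip2 (F (Suc i) j))"]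
        wsg[of \<phi> j "push flip2 (F (Suc i) j)"]
      by (auto simp: W_def)
  qed
  \<comment> \<open>Modulo 2 the recursion is Pascal's rule, with \<open>W\<close> zero on the
    border and odd at the shifted corner \<open>W 1 1\<close>.\<close>
  have W_binomial: "odd (W (Suc i) (Suc j)) \<longleftrightarrow> odd ((i + j) choose i)" if "i < m" "j < m" for i j
    using that
  proof (induction "i + j" arbitrary: i j rule: less_induct)
    case less
    have W0: "W 0 j = 0" "W i 0 = 0" for i j by (auto simp: W_def F0)
    show ?case
    proof (cases i; cases j)
      fix i' j' assume ij: "i = Suc i'" "j = Suc j'"
      then have "odd (W i (Suc j)) \<longleftrightarrow> odd ((i' + j) choose i')" "odd (W (Suc i) j) \<longleftrightarrow> odd ((i + j') choose i)"
        using less.hyps[of i' j] less.hyps[of i j'] less.prems by auto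
      moreover have "(i + j) choose i = ((i' + j) choose i') + ((i + j') choose i)"
        by (simp add: ij)
      ultimately show ?thesis using W_rec[OF less.prems] by (auto simp: ij)
    next
      fix i' assume ij: "i = Suc i'" "j = 0"
      then have "odd (W i (Suc j))" using less.hyps[of i' j] less.prems by auto
      then show ?thesis using W_rec[OF less.prems] by (auto simp: ij W0)
    next
      fix j' assume ij: "i = 0" "j = Suc j'"
      then have "odd (W (Suc i) j)" using less.hyps[of i j'] less.prems by auto
      then show ?thesis using W_rec[OF less.prems] by (auto simp: ij W0)
    qed (use W_rec[OF less.prems] W0 in auto)
  qed
  have "W (Suc i) (Suc j) \<noteq> 0" using W_binomial[of i j] assms m_def by auto
  then obtain \<tau> where t: "\<tau> \<in> support (F (Suc i) (Suc j))" "\<phi> \<tau> \<noteq> 0 \<or> \<psi> \<tau> \<noteq> 0"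
    unfolding W_def weight_def by (metis (no_types, lifting) add.left_neutral mult_zero_right sum.neutral)
  then obtain s where "alternating s (sort_key abs (map L \<tau>))"
    unfolding \<phi>_def \<psi>_def alt_indicator_def by (auto simp: of_bool_def split: if_splits)
  moreover have "dist p q < \<delta>" if "p \<in> set \<tau>" "q \<in> set \<tau>" for p q
    using supp(3)[OF t(1) _ _ that] N \<open>i < DIM('a)\<close> \<open>j < DIM('a)\<close> unfolding m_def by linarith
  ultimately show thesis using that[of \<tau> s] supp(1,2)[OF t(1)] assms m_def by auto
qed


section \<open>Ky Fan's theorem for coverings of a product of spheres\<close>

text \<open>Consecutive entries have opposite signs, so equal absolute values would make them
  negatives of each other.\<close>

lemma alternating_sorted_strict:
  assumes "sorted (map abs xs)" "alternating s xs" "\<forall>x\<in>set xs. \<forall>y\<in>set xs. x \<noteq> - y" "s \<noteq> 0"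
  shows "sorted_wrt (<) (map abs xs)"
  using assms
proof (induction xs arbitrary: s)
  case (Cons x xs)
  then have *: "sorted_wrt (<) (map abs xs)" by (intro Cons.IH[of "- s"]) auto
  have "\<bar>x\<bar> < \<bar>y\<bar>" if "y \<in> set xs" for y
  proof (cases xs)
    case (Cons z zs)
    then have "sgn z = - s" "sgn x = s" "\<bar>x\<bar> \<le> \<bar>z\<bar>" "x \<noteq> - z" using Cons.prems by auto
    then have "\<bar>x\<bar> < \<bar>z\<bar>" using \<open>s \<noteq> 0\<close> by (auto simp: abs_if sgn_if split: if_splits)
    moreover have "\<bar>z\<bar> \<le> \<bar>y\<bar>" using * that Cons by auto
    ultimately show ?thesis by simp
  qed (use that in auto)
  then show ?case using * by simp
qed auto

lemma dist_flip [simp]: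
  fixes p q :: "'a::real_normed_vector \<times> 'a"
  shows "dist (flip1 p) (flip1 q) = dist p q" "dist (flip2 p) (flip2 q) = dist p q"
  by (simp_all add: flip1_def flip2_def dist_prod_def dist_norm norm_minus_commute)

lemma flip_flip [simp]: "flip1 (flip1 p) = (p :: 'a::real_vector \<times> 'a)" "flip2 (flip2 p) = p"
  by (simp_all add: flip1_def flip2_def)

lemma flip_octahedral:
  fixes p :: "'a::euclidean_space \<times> 'a"
  assumes "p \<in> octahedral_sphere \<times> octahedral_sphere"
  shows "flip1 p \<in> octahedral_sphere \<times> octahedral_sphere" "flip2 p \<in> octahedral_sphere \<times> octahedral_sphere"
  using assms by (auto simp: flip1_def flip2_def octahedral_sphere_def)

text \<open>A point is labeled by a set of the covering that contains a whole ball around it. An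
  alternating simplex smaller than this ball has each of its vertices in all the sets named by its
  labels.\<close>

theorem fan_covering:
  fixes U :: "int \<Rightarrow> ('a::euclidean_space \<times> 'a) set"
  defines "X \<equiv> octahedral_sphere \<times> octahedral_sphere"
  assumes opn: "\<And>l. open (U l)" and cov: "X \<subseteq> (\<Union>l. U l)"
    and U1: "\<And>p l. p \<in> X \<Longrightarrow> p \<in> U l \<Longrightarrow> flip1 p \<in> U (- l)"
    and U2: "\<And>p l. p \<in> X \<Longrightarrow> p \<in> U l \<Longrightarrow> flip2 p \<in> U (- l)"
    and opp: "\<And>p l. p \<in> X \<Longrightarrow> p \<in> U l \<Longrightarrow> p \<notin> U (- l)"
    and ij: "i < DIM('a)" "j < DIM('a)" "odd ((i + j) choose i)"
  obtains p s ls where "p \<in> X" "length ls = Suc (i + j)" "sorted_wrt (<) (map abs ls)"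
    "alternating s ls" "\<And>l. l \<in> set ls \<Longrightarrow> p \<in> U l"
proof -
  have "compact X" unfolding X_def by (intro compact_Times compact_octahedral_sphere)
  then obtain \<delta> where d: "\<delta> > 0" "\<And>p. p \<in> X \<Longrightarrow> \<exists>G\<in>range U. ball p \<delta> \<subseteq> G"
    by (rule Heine_Borel_lemma[of X "range U"]) (use cov opn in auto)
  \<comment> \<open>For \<open>p\<close> in \<open>X\<close>, the set \<open>A p\<close> is nonempty
    since \<open>\<delta>\<close> is a Lebesgue number, and it never contains both \<open>l\<close>
    and \<open>- l\<close>. Choosing the least absolute value thus fixes one label and makes the
    choice odd under the flips.\<close>
  define A where "A p = {l. X \<inter> ball p \<delta> \<subseteq> U l}" for p
  define n where "n p = (LEAST k. \<exists>l\<in>A p. nat \<bar>l\<bar> = k)" for p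
  define L where "L p = (if int (n p) \<in> A p then int (n p) else - int (n p))" for p
  have A_opp: "- l \<notin> A p" if "p \<in> X" "l \<in> A p" for p l
  proof -
    have "p \<in> X \<inter> ball p \<delta>" using that(1) d(1) by simp
    then show ?thesis using that opp[of p l] unfolding A_def by blast
  qed
  have A_flip: "l \<in> A (f p) \<longleftrightarrow> - l \<in> A p" if "f \<in> {flip1, flip2}" "p \<in> X" for f p l
  proof -
    have 1: "- l \<in> A (f p)" if "l \<in> A p" "p \<in> X" for l p
    proof -
      have "q \<in> U (- l)" if "q \<in> X" "dist (f p) q < \<delta>" for q
      proof -
        have "dist p (f q) < \<delta>" using \<open>f \<in> _\<close> that(2) by (metis dist_flip flip_flip insertE singletonD)
        moreover have "f q \<in> X" using flip_octahedral \<open>f \<in> _\<close> that(1) unfolding X_def by blast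
        ultimately have "f q \<in> U l" using \<open>l \<in> A p\<close> by (auto simp: A_def)
        then have "f (f q) \<in> U (- l)" using U1 U2 \<open>f q \<in> X\<close> \<open>f \<in> _\<close> by blast
        then show ?thesis using \<open>f \<in> _\<close> by auto
      qed
      then show ?thesis by (auto simp: A_def)
    qed
    have "f p \<in> X" "f (f p) = p" using flip_octahedral that unfolding X_def by auto
    then show ?thesis using 1[of "- l" p] 1[of l "f p"] \<open>p \<in> X\<close> by auto
  qed
  have L_in: "L p \<in> A p" if "p \<in> X" for p
  proof -
    have "\<exists>k. \<exists>l\<in>A p. nat \<bar>l\<bar> = k" using d(2)[OF that] by (auto simp: A_def)
    then have "\<exists>l\<in>A p. nat \<bar>l\<bar> = n p" unfolding n_def by (rule LeastI_ex)
    then obtain l where l: "l \<in> A p" "nat \<bar>l\<bar> = n p" by blast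
    then have "l = int (n p) \<or> l = - int (n p)" by linarith
    then show ?thesis using l(1) by (auto simp: L_def)
  qed
  have L_flip: "L (f p) = - L p" if "f \<in> {flip1, flip2}" "p \<in> X" for f p
  proof -
    have "(\<exists>l\<in>A (f p). nat \<bar>l\<bar> = k) \<longleftrightarrow> (\<exists>l\<in>A p. nat \<bar>l\<bar> = k)" for k
      using A_flip[OF that] by (metis abs_minus_cancel minus_minus)
    then have n: "n (f p) = n p" by (simp add: n_def)
    have "- L p \<in> A (f p)" using A_flip[OF that, of "- L p"] L_in[OF that(2)] by simp
    moreover have "L p \<notin> A (f p)" using A_flip[OF that, of "L p"] A_opp[OF that(2) L_in[OF that(2)]] by simp
    ultimately show ?thesis by (auto simp: L_def n split: if_splits)
  qed
  have L_ne: "L p \<noteq> 0" if "p \<in> X" for p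
    using A_opp[OF that L_in[OF that]] L_in[OF that] by auto
  obtain \<tau> s where t: "length \<tau> = Suc (i + j)" "set \<tau> \<subseteq> X"
    "\<And>p q. p \<in> set \<tau> \<Longrightarrow> q \<in> set \<tau> \<Longrightarrow> dist p q < \<delta>" "alternating s (sort_key abs (map L \<tau>))"
    by (rule fan_product_of_spheres[of L i j \<delta>]) (use L_ne L_flip ij d(1) in \<open>auto simp: X_def\<close>)
  define ls where "ls = sort_key abs (map L \<tau>)"
  \<comment> \<open>Any vertex would do: it is within \<open>\<delta>\<close> of every vertex
    \<open>q\<close>, hence in \<open>U (L q)\<close>.\<close>
  define p where "p = hd \<tau>"
  have p: "p \<in> set \<tau>" using t(1) by (cases \<tau>) (auto simp: p_def)
  have pU: "p \<in> U l" if "l \<in> set ls" for l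
  proof -
    obtain q where q: "q \<in> set \<tau>" "l = L q" using \<open>l \<in> set ls\<close> by (auto simp: ls_def)
    have "L q \<in> A q" using L_in t(2) q(1) by blast
    moreover have "p \<in> X \<inter> ball q \<delta>" using t(2) p t(3)[OF q(1) p] by auto
    ultimately show ?thesis using q(2) unfolding A_def by blast
  qed
  have "ls \<noteq> []" using t(1) by (metis Zero_not_Suc length_map length_sort list.size(3) ls_def)
  then obtain a as where "ls = a # as" by (cases ls) auto
  moreover have "a \<noteq> 0" if "a \<in> set ls" for a
    using that L_ne t(2) by (auto simp: ls_def)
  ultimately have "s \<noteq> 0" using t(4) by (auto simp: ls_def[symmetric] sgn_0_0)
  have "sorted_wrt (<) (map abs ls)"
  proof (rule alternating_sorted_strict[OF _ _ _ \<open>s \<noteq> 0\<close>])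
    show "\<forall>x\<in>set ls. \<forall>y\<in>set ls. x \<noteq> - y" using pU opp t(2) p by blast
  qed (use t(4) in \<open>simp_all add: ls_def\<close>)
  then show thesis
    using that[of p ls s] pU p t by (auto simp: ls_def)
qed


section \<open>Simplicial complexes\<close>

lemma sign_changes_Cons_le: "sign_changes xs \<le> sign_changes (x # xs)"
  by (cases xs) auto

text \<open>A change of sign from one entry to a later one forces a change at one of the steps in
  between, so deletions create no changes; \<open>aux\<close> is this triangle inequality.\<close>

lemma sign_changes_subseq:
  assumes "subseq xs ys" "\<forall>y\<in>set ys. y \<noteq> 0"
  shows "sign_changes xs \<le> sign_changes ys"
proof -
  have aux: "sign_changes (a # xs) \<le> (if sgn a \<noteq> sgn b then 1 else 0) + sign_changes (b # xs)" for a b xs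
    by (cases xs) auto
  have "sign_changes xs \<le> sign_changes ys \<and> (xs \<noteq> [] \<longrightarrow> (\<forall>a. sign_changes (a # xs) \<le> sign_changes (a # ys)))"
    if "subseq xs ys" for xs ys :: "int list"
    using that
  proof (induction rule: list_emb.induct)
    case (list_emb_Nil ys)
    then show ?case by simp
  next
    case (list_emb_Cons xs ys y)
    have 1: "sign_changes xs \<le> sign_changes (y # ys)"
      using list_emb_Cons sign_changes_Cons_le[of ys y] by simp
    moreover have "sign_changes (a # xs) \<le> sign_changes (a # y # ys)" if "xs \<noteq> []" for a
    proof -
      have "sign_changes (a # xs) \<le> (if sgn a \<noteq> sgn y then 1 else 0) + sign_changes (y # xs)" by (rule aux)
      also have "\<dots> \<le> (if sgn a \<noteq> sgn y then 1 else 0) + sign_changes (y # ys)"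
        using list_emb_Cons that by auto
      finally show ?thesis by simp
    qed
    ultimately show ?case by blast
  next
    case (list_emb_Cons2 x y xs ys)
    have "sign_changes (y # xs) \<le> sign_changes (y # ys)"
      using list_emb_Cons2 by (cases "xs = []") auto
    then show ?case using list_emb_Cons2 by auto
  qed
  then show ?thesis using assms by blast
qed

text \<open>Filtering the sorted list by membership in \<open>ls\<close> gives the same set of
  entries in increasing absolute value; injectivity of \<open>abs\<close> makes the two lists
  equal.\<close>

lemma sorted_sublist_abs:
  fixes ls :: "int list"
  assumes "sorted_wrt (<) (map abs ls)" "set ls \<subseteq> S" "finite S" "inj_on abs S"
  shows "subseq ls (sort_key abs (sorted_list_of_set S))"
proof -
  define xs where "xs = filter (\<lambda>x. x \<in> set ls) (sort_key abs (sorted_list_of_set S))"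
  have set: "set xs = set ls" using assms by (auto simp: xs_def)
  have inj: "inj_on abs (set xs \<union> set ls)" using set assms(2,4) by (auto intro: inj_on_subset)
  have "sorted (map abs xs)" unfolding xs_def by (rule sorted_filter) simp
  moreover have "distinct (map abs xs)"
    using inj by (auto simp: distinct_map xs_def intro: inj_on_subset)
  moreover have "sorted (map abs ls)" "distinct (map abs ls)"
    using assms(1) by (auto simp: strict_sorted_iff)
  ultimately have "map abs xs = map abs ls"
    by (intro sorted_distinct_set_unique) (use set in auto)
  then have "xs = ls" using inj by (simp add: inj_on_map_eq_map)
  then show ?thesis by (metis subseq_filter_left xs_def)
qed

text \<open>For a vertex \<open>w\<close> of \<open>K\<close> in \<open>\<sigma>\<close>, the
  intersection \<open>{w}\<close> is a face of \<open>\<sigma>\<close>, so \<open>w\<close> is an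
  extreme point. Hence the vertices of \<open>K\<close> in \<open>\<sigma>\<close> are its corners,
  and faces correspond to subsets of them.\<close>

lemma simplex_faces:
  fixes K :: "'k::euclidean_space set set"
  assumes K: "simplicial_complex K" and "\<sigma> \<in> K"
  shows "finite (vertices K \<inter> \<sigma>)" "\<not> affine_dependent (vertices K \<inter> \<sigma>)"
    "\<sigma> = convex hull (vertices K \<inter> \<sigma>)" "\<And>D. D \<subseteq> vertices K \<inter> \<sigma> \<Longrightarrow> convex hull D \<in> K"
proof -
  obtain n where "n simplex \<sigma>" using assms by (auto simp: simplicial_complex_def)
  then obtain C where C: "finite C" "\<not> affine_dependent C" "\<sigma> = convex hull C"
    by (auto simp: simplex)
  have faces: "convex hull D \<in> K" if "D \<subseteq> C" for D
  proof -
    have "convex hull D face_of \<sigma>"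
      unfolding C(3) face_of_convex_hull_affine_independent[OF C(2)] using that by blast
    then show ?thesis using assms by (auto simp: simplicial_complex_def)
  qed
  have eq: "C = vertices K \<inter> \<sigma>"
  proof
    show "C \<subseteq> vertices K \<inter> \<sigma>"
    proof
      fix w assume "w \<in> C"
      then show "w \<in> vertices K \<inter> \<sigma>"
        using faces[of "{w}"] C(3) by (auto simp: vertices_def hull_inc)
    qed
    show "vertices K \<inter> \<sigma> \<subseteq> C"
    proof
      fix w assume w: "w \<in> vertices K \<inter> \<sigma>"
      then have "\<sigma> \<inter> {w} face_of \<sigma>"
        using K \<open>\<sigma> \<in> K\<close> unfolding simplicial_complex_def vertices_def by blast
      then have "w extreme_point_of \<sigma>" using w by (simp add: face_of_singleton)
      then show "w \<in> C" using extreme_point_of_convex_hull C(3) by blast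
    qed
  qed
  show "finite (vertices K \<inter> \<sigma>)" "\<not> affine_dependent (vertices K \<inter> \<sigma>)"
    "\<sigma> = convex hull (vertices K \<inter> \<sigma>)" "\<And>D. D \<subseteq> vertices K \<inter> \<sigma> \<Longrightarrow> convex hull D \<in> K"
    using C faces unfolding eq[symmetric] by blast+
qed

text \<open>In a simplicial complex this is the union of the relative interiors of the simplices
  containing \<open>\<sigma>\<close>. In this form its complement in the polyhedron is a finite
  union of closed simplices.\<close>

definition open_star :: "'k::euclidean_space set set \<Rightarrow> 'k set \<Rightarrow> 'k set" where
  "open_star K \<sigma> = {x \<in> \<Union>K. \<forall>\<rho>\<in>K. x \<in> \<rho> \<longrightarrow> \<sigma> \<subseteq> \<rho>}"

lemma openin_open_star:
  assumes "simplicial_complex K"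
  shows "openin (top_of_set (\<Union>K)) (open_star K \<sigma>)"
proof -
  have "finite K" using assms by (auto simp: simplicial_complex_def)
  moreover have "closed \<rho>" if "\<rho> \<in> K" for \<rho>
    using assms that closed_simplex unfolding simplicial_complex_def by blast
  ultimately have "closed (\<Union>{\<rho> \<in> K. \<not> \<sigma> \<subseteq> \<rho>})" by (intro closed_Union) auto
  moreover have "open_star K \<sigma> = \<Union>K \<inter> - \<Union>{\<rho> \<in> K. \<not> \<sigma> \<subseteq> \<rho>}"
    by (auto simp: open_star_def)
  ultimately show ?thesis by (auto simp: openin_open)
qed

text \<open>The smallest simplex through \<open>x\<close> is contained in every other one, so any of
  its vertices serves.\<close>

lemma open_star_cover:
  assumes K: "simplicial_complex K" and "x \<in> \<Union>K"
  obtains w where "w \<in> vertices K" "x \<in> open_star K {w}"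
proof -
  have "finite {\<rho> \<in> K. x \<in> \<rho>}" "{\<rho> \<in> K. x \<in> \<rho>} \<noteq> {}"
    using assms by (auto simp: simplicial_complex_def)
  then obtain \<rho> where r: "\<rho> \<in> K" "x \<in> \<rho>" and min: "\<And>\<tau>. \<tau> \<in> K \<Longrightarrow> x \<in> \<tau> \<Longrightarrow> \<tau> \<subseteq> \<rho> \<Longrightarrow> \<rho> = \<tau>"
    using finite_has_minimal[of "{\<rho> \<in> K. x \<in> \<rho>}"] by auto
  have sub: "\<rho> \<subseteq> \<tau>" if "\<tau> \<in> K" "x \<in> \<tau>" for \<tau>
  proof -
    have "\<rho> \<inter> \<tau> \<in> K" using K r that unfolding simplicial_complex_def by blast
    then show ?thesis using min[of "\<rho> \<inter> \<tau>"] r that by blast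
  qed
  obtain w where "w \<in> vertices K" "w \<in> \<rho>"
    using simplex_faces(3)[OF K r(1)] r(2) by (metis IntD1 IntD2 convex_hull_eq_empty empty_iff equals0I)
  then show thesis using that[of w] sub assms(2) unfolding open_star_def by blast
qed

text \<open>A face of \<open>\<sigma>\<close> that meets the relative interior is all of
  \<open>\<sigma>\<close>; apply this to the intersection with another simplex.\<close>

lemma rel_interior_subset_open_star:
  assumes K: "simplicial_complex K" and "\<sigma> \<in> K"
  shows "rel_interior \<sigma> \<subseteq> open_star K \<sigma>"
proof
  fix x assume x: "x \<in> rel_interior \<sigma>"
  have "\<sigma> \<subseteq> \<rho>" if "\<rho> \<in> K" "x \<in> \<rho>" for \<rho>
  proof -
    have "\<sigma> \<inter> \<rho> face_of \<sigma>" using K assms that unfolding simplicial_complex_def by blast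
    moreover have "\<sigma> \<inter> \<rho> \<inter> rel_interior \<sigma> \<noteq> {}" using x that rel_interior_subset[of \<sigma>] by blast
    ultimately have "\<sigma> \<subseteq> \<sigma> \<inter> \<rho>" by (meson order_refl subset_of_face_of)
    then show ?thesis by blast
  qed
  then show "x \<in> open_star K \<sigma>" using x \<open>\<sigma> \<in> K\<close> rel_interior_subset[of \<sigma>] by (auto simp: open_star_def)
qed

text \<open>The two alternatives contradict invariance of dimension and invariance of domain,
  respectively, if the star of \<open>\<sigma>\<close> is open in a manifold of dimension \<open>aff_dim \<sigma> + 1\<close>.\<close>

lemma at_most_one_coface:
  assumes K: "simplicial_complex K" and "\<sigma> \<in> K"
    and one: "\<And>\<tau> \<tau>'. \<tau> \<in> K \<Longrightarrow> \<tau>' \<in> K \<Longrightarrow> \<sigma> \<subset> \<tau> \<Longrightarrow> \<sigma> \<subset> \<tau>' \<Longrightarrow> \<tau> = \<tau>'"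
  obtains \<tau> where "\<tau> \<in> K" "\<sigma> face_of \<tau>" "open_star K \<sigma> \<subseteq> \<tau>" "\<tau> = \<sigma> \<or> aff_dim \<tau> = aff_dim \<sigma> + 1"
proof (cases "\<exists>\<tau>\<in>K. \<sigma> \<subset> \<tau>")
  case False
  then have "open_star K \<sigma> \<subseteq> \<sigma>" by (auto simp: open_star_def)
  moreover have "\<sigma> face_of \<sigma>"
    using K \<open>\<sigma> \<in> K\<close> convex_simplex face_of_refl unfolding simplicial_complex_def by blast
  ultimately show thesis using that[of \<sigma>] \<open>\<sigma> \<in> K\<close> by blast
next
  case True
  then obtain \<tau> where t: "\<tau> \<in> K" "\<sigma> \<subset> \<tau>" by blast
  define C D where "C = vertices K \<inter> \<sigma>" and "D = vertices K \<inter> \<tau>"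
  have C: "finite C" "\<not> affine_dependent C" "\<sigma> = convex hull C" "C = vertices K \<inter> \<sigma>"
    unfolding C_def using simplex_faces[OF K \<open>\<sigma> \<in> K\<close>] by blast+
  have D: "finite D" "\<not> affine_dependent D" "\<tau> = convex hull D" "D = vertices K \<inter> \<tau>"
    "\<And>D'. D' \<subseteq> D \<Longrightarrow> convex hull D' \<in> K"
    unfolding D_def using simplex_faces[OF K t(1)] by blast+
  have "C \<subset> D" using t(2) C D by blast
  then obtain w where w: "w \<in> D" "w \<notin> C" by blast
  have "\<not> affine_dependent (insert w C)"
    using affine_independent_subset[OF D(2)] w(1) \<open>C \<subset> D\<close> by blast
  \<comment> \<open>One additional vertex already spans a proper coface, so uniqueness makes it all
    of \<open>\<tau>\<close> and fixes the dimension.\<close>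
  have "convex hull (insert w C) \<in> K" using D(5) w(1) \<open>C \<subset> D\<close> by blast
  moreover have "\<sigma> \<subset> convex hull (insert w C)"
  proof -
    have "\<sigma> \<subseteq> convex hull (insert w C)" unfolding C(3) by (rule hull_mono) blast
    moreover have "w \<in> convex hull (insert w C)" by (simp add: hull_inc)
    moreover have "w \<notin> \<sigma>" using w C(4) D(4) by blast
    ultimately show ?thesis by blast
  qed
  ultimately have \<tau>: "\<tau> = convex hull (insert w C)" using one t by blast
  have "int (card (insert w C)) = aff_dim \<tau> + 1" "int (card C) = aff_dim \<sigma> + 1"
    using aff_dim_affine_independent[OF C(2)] aff_dim_affine_independent[OF \<open>\<not> affine_dependent (insert w C)\<close>]
    by (simp_all add: \<tau> C(3) aff_dim_convex_hull)
  then have "aff_dim \<tau> = aff_dim \<sigma> + 1" using w(2) C(1) by simp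
  moreover have "\<sigma> face_of \<tau>"
    unfolding \<tau> face_of_convex_hull_affine_independent[OF \<open>\<not> affine_dependent (insert w C)\<close>]
    using C(3) by blast
  moreover have "open_star K \<sigma> \<subseteq> \<tau>"
  proof
    fix x assume "x \<in> open_star K \<sigma>"
    then obtain \<rho> where r: "\<rho> \<in> K" "x \<in> \<rho>" "\<sigma> \<subseteq> \<rho>" unfolding open_star_def by blast
    show "x \<in> \<tau>"
    proof (cases "\<rho> = \<sigma>")
      case False
      then show ?thesis using one[OF t(1) r(1) t(2)] r by blast
    qed (use r t(2) in blast)
  qed
  ultimately show thesis using that t(1) by blast
qed

lemma affine_Times_UNIV: "affine A \<Longrightarrow> affine (A \<times> UNIV)"
  unfolding affine_def by (simp add: mem_Times_iff)

lemma aff_dim_Times_UNIV: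
  fixes A :: "'a::euclidean_space set"
  assumes "affine A" "A \<noteq> {}"
  shows "aff_dim (A \<times> (UNIV :: 'b::euclidean_space set)) = aff_dim A + int DIM('b)"
proof -
  obtain L where L: "subspace L" "affine_parallel A L" using affine_parallel_subspace[OF assms] by blast
  then obtain a where a: "L = (+) a ` A" by (auto simp: affine_parallel_def)
  have "L \<times> (UNIV :: 'b set) = (+) (a, 0) ` (A \<times> UNIV)"
    by (force simp: a image_iff)
  then have par: "affine_parallel (A \<times> (UNIV :: 'b set)) (L \<times> UNIV)" unfolding affine_parallel_def by blast
  have hull: "affine hull (A \<times> (UNIV :: 'b set)) = A \<times> UNIV"
    using affine_Times_UNIV[OF assms(1)] by (rule affine_hull_eq[THEN iffD2])
  have "aff_dim (A \<times> (UNIV :: 'b set)) = int (dim (L \<times> (UNIV :: 'b set)))"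
  proof (rule aff_dim_parallel_subspace)
    show "subspace (L \<times> (UNIV :: 'b set))" by (intro subspace_Times L subspace_UNIV)
    show "affine_parallel (affine hull (A \<times> (UNIV :: 'b set))) (L \<times> UNIV)" unfolding hull by (rule par)
  qed (use assms(2) in simp)
  also have "\<dots> = int (dim L) + int DIM('b)"
    using dim_Times[OF L(1) subspace_UNIV[where 'a = 'b]] by simp
  also have "int (dim L) = aff_dim A"
    using aff_dim_parallel_subspace[OF assms(2) L(1)] L(2) affine_hull_eq[THEN iffD2, OF assms(1)] by simp
  finally show ?thesis .
qed

text \<open>The Euclidean factor allows the use of frames, which form an open subset of a vector
  space, in place of charts of the sphere bundle.\<close>

lemma open_map_into_coface:
  fixes F :: "'a::euclidean_space \<Rightarrow> 'k::euclidean_space \<times> 'b::euclidean_space"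
  assumes "open \<Omega>" "p \<in> \<Omega>" "continuous_on \<Omega> F" "inj_on F \<Omega>"
    and F: "F ` \<Omega> \<subseteq> \<tau> \<times> UNIV" "fst (F p) \<in> \<sigma>" and "convex \<tau>" "\<sigma> face_of \<tau>"
    and dim: "int DIM('a) = aff_dim \<sigma> + 1 + int DIM('b)" "\<tau> = \<sigma> \<or> aff_dim \<tau> = aff_dim \<sigma> + 1"
  shows False
proof -
  let ?A = "(affine hull \<tau>) \<times> (UNIV :: 'b set)"
  have ne: "affine hull \<tau> \<noteq> {}" using F assms(2) by auto
  have aff: "affine ?A" by (rule affine_Times_UNIV[OF affine_affine_hull])
  have dA: "aff_dim ?A = aff_dim \<tau> + int DIM('b)"
    using aff_dim_Times_UNIV[OF affine_affine_hull ne] by simp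
  have im: "F \<in> \<Omega> \<rightarrow> ?A"
  proof
    fix x assume "x \<in> \<Omega>"
    then have "fst (F x) \<in> \<tau>" using F(1) by (metis imageI mem_Times_iff subsetD)
    then show "F x \<in> ?A" by (simp add: mem_Times_iff hull_inc)
  qed
  \<comment> \<open>Invariance of dimension rules out \<open>\<tau> = \<sigma>\<close>, where the
    target would have one dimension too few.\<close>
  have "aff_dim (UNIV :: 'a set) \<le> aff_dim ?A"
  proof (rule invariance_of_dimension_affine_sets[OF _ affine_UNIV aff assms(3) im assms(4)])
    show "openin (top_of_set UNIV) \<Omega>" using assms(1) by simp
  qed (use assms(2) in blast)
  then have dt: "aff_dim \<tau> = aff_dim \<sigma> + 1" unfolding dA using dim by auto
  \<comment> \<open>The dimensions now agree, so the image is open by invariance of domain. Its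
    slice through \<open>F p\<close> makes \<open>fst (F p)\<close> a relative interior point of
    \<open>\<tau>\<close>, although it lies on the proper face \<open>\<sigma>\<close>.\<close>
  have "openin (top_of_set ?A) (F ` \<Omega>)"
  proof (rule invariance_of_domain_affine_sets[OF _ affine_UNIV aff _ assms(3) im assms(4)])
    show "openin (top_of_set UNIV) \<Omega>" using assms(1) by simp
    show "aff_dim ?A \<le> aff_dim (UNIV :: 'a set)" unfolding dA dt using dim(1) by simp
  qed
  then obtain T where T: "open T" "F ` \<Omega> = ?A \<inter> T" by (auto simp: openin_open)
  define T' where "T' = {z. (z, snd (F p)) \<in> T}"
  have "open T'"
  proof -
    have "T' = (\<lambda>z. (z, snd (F p))) -` T" by (auto simp: T'_def)
    then show ?thesis using continuous_open_vimage[OF T(1), of "\<lambda>z. (z, snd (F p))"]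
      by (simp add: continuous_intros)
  qed
  have Fp: "F p \<in> ?A \<inter> T" using T(2) assms(2) by blast
  then have "fst (F p) \<in> affine hull \<tau>" "F p \<in> T" by (simp_all add: mem_Times_iff)
  then have "fst (F p) \<in> T' \<inter> affine hull \<tau>" by (simp add: T'_def)
  moreover have "T' \<inter> affine hull \<tau> \<subseteq> \<tau>"
  proof
    fix z assume "z \<in> T' \<inter> affine hull \<tau>"
    then have "(z, snd (F p)) \<in> ?A \<inter> T" by (simp add: T'_def)
    then have "(z, snd (F p)) \<in> \<tau> \<times> UNIV" using T(2) F(1) by blast
    then show "z \<in> \<tau>" by simp
  qed
  moreover have "fst (F p) \<in> \<tau>" using F(1) assms(2) by (metis imageI mem_Times_iff subsetD)
  ultimately have "fst (F p) \<in> rel_interior \<tau>"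
    unfolding mem_rel_interior using \<open>open T'\<close> by blast
  moreover have "\<sigma> \<noteq> \<tau>" using dt by auto
  ultimately show False using face_of_disjoint_rel_interior[OF \<open>\<sigma> face_of \<tau>\<close>] F(2) by blast
qed


section \<open>The sphere bundle of projective space\<close>

definition perp :: "'a::real_inner \<Rightarrow> 'a \<Rightarrow> 'a" where
  "perp x y = y - ((x \<bullet> y) / (x \<bullet> x)) *\<^sub>R x"

text \<open>The linearly independent pairs, described so that openness follows from the continuity
  of \<open>perp\<close>.\<close>

definition frames :: "('a::real_inner \<times> 'a) set" where
  "frames = {p. fst p \<noteq> 0 \<and> perp (fst p) (snd p) \<noteq> 0}"

lemma continuous_on_perp:
  "continuous_on S (\<lambda>p. perp (fst p) (snd p))" if "\<And>p. p \<in> S \<Longrightarrow> fst p \<noteq> 0"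
  unfolding perp_def using that by (intro continuous_intros) auto

lemma open_frames: "open (frames :: ('a::real_inner \<times> 'a) set)"
proof -
  let ?S = "{p :: 'a \<times> 'a. fst p \<noteq> 0}"
  have S: "open ?S" by (intro open_Collect_neq continuous_intros)
  have "open (?S \<inter> (\<lambda>p. perp (fst p) (snd p)) -` (- {0}))"
    by (rule continuous_open_preimage[OF continuous_on_perp S]) auto
  moreover have "?S \<inter> (\<lambda>p. perp (fst p) (snd p)) -` (- {0}) = frames"
    by (auto simp: frames_def)
  ultimately show ?thesis by simp
qed

lemma inner_perp: "x \<bullet> perp x y = 0"
  by (cases "x = 0") (auto simp: perp_def inner_diff_right)

lemma perp_minus: "perp (- x) y = perp x y" "perp x (- y) = - perp x y"
  by (auto simp: perp_def)

lemma perp_orthogonal: "x \<bullet> y = 0 \<Longrightarrow> perp x y = y"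
  by (simp add: perp_def)

lemma orbit_pm_minus: "orbit_pm (- p) = orbit_pm (p :: 'a::group_add)"
  by (auto simp: orbit_pm_def)

lemma orbit_pm_eq_iff: "orbit_pm p = orbit_pm q \<longleftrightarrow> p = q \<or> p = - q" for p q :: "'a::real_vector"
  by (auto simp: orbit_pm_def doubleton_eq_iff)

lemma topspace_total_RP: "topspace (total (tangent_RP :: ((((real^'n) \<times> (real^'n)) set, (real^'n) set) vbundle)))
    = orbit_pm ` tangent_sphere"
  by (simp add: tangent_RP_def topspace_quotient_topology)

lemma continuous_map_orbit_pm:
  "continuous_map (top_of_set tangent_sphere)
    (total (tangent_RP :: ((((real^'n) \<times> (real^'n)) set, (real^'n) set) vbundle))) orbit_pm"
  by (simp add: tangent_RP_def quotient_imp_continuous_map quotient_map_quotient_topology)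

lemma antipode_RP: "antipode tangent_RP (orbit_pm (x, v)) = orbit_pm (x, - v)"
  by (simp add: antipode_def fscale_tangent_RP)

lemma orbit_pm_in_fiber:
  assumes "(x, v) \<in> tangent_sphere"
  shows "orbit_pm (x, v) \<in> fiber tangent_RP (orbit_pm x)" "orbit_pm x \<in> topspace (base tangent_RP)"
  using assms by (auto simp: fiber_def topspace_total_RP proj_tangent_RP)
    (auto simp: tangent_RP_def real_projective_space_def topspace_quotient_topology tangent_sphere_def)

lemma tangent_sphere_scale: "(x, v) \<in> tangent_sphere \<Longrightarrow> (x, a *\<^sub>R v) \<in> tangent_sphere"
  by (auto simp: tangent_sphere_def)

section \<open>Gram-Schmidt for an arbitrary fiberwise metric\<close>

context
  fixes g :: "((real^'n) \<times> (real^'n)) set \<Rightarrow> ((real^'n) \<times> (real^'n)) set \<Rightarrow> real"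
  assumes g: "fiberwise_metric (tangent_RP :: ((((real^'n) \<times> (real^'n)) set, (real^'n) set) vbundle)) g"
begin

definition sqnorm :: "(real^'n) \<times> (real^'n) \<Rightarrow> real" where
  "sqnorm p = g (orbit_pm p) (orbit_pm p)"

lemma sqnorm_scale:
  assumes "(x, v) \<in> tangent_sphere"
  shows "sqnorm (x, a *\<^sub>R v) = a\<^sup>2 * sqnorm (x, v)"
proof -
  note F = orbit_pm_in_fiber[OF assms] orbit_pm_in_fiber[OF tangent_sphere_scale[OF assms, of a]]
  have lin: "g (fscale tangent_RP a c) d = a * g c d" "g c d = g d c"
    if "c \<in> fiber tangent_RP (orbit_pm x)" "d \<in> fiber tangent_RP (orbit_pm x)" for c d
    using conjunct2[OF g[unfolded fiberwise_metric_def], THEN bspec, OF F(2)] that by simp_all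
  show ?thesis
    using lin(1)[OF F(1) F(3)] lin(1)[OF F(1) F(1)] lin(2)[OF F(1) F(3)]
    by (simp add: sqnorm_def fscale_tangent_RP power2_eq_square)
qed

lemma sqnorm_minus: "(x, v) \<in> tangent_sphere \<Longrightarrow> sqnorm (x, - v) = sqnorm (x, v)"
  using sqnorm_scale[of x v "-1"] by simp

lemma sqnorm_zero: "(x, 0) \<in> tangent_sphere \<Longrightarrow> sqnorm (x, 0) = 0"
  using sqnorm_scale[of x 0 0] by simp

lemma sqnorm_pos:
  assumes "(x, v) \<in> tangent_sphere" "v \<noteq> 0"
  shows "sqnorm (x, v) > 0"
proof -
  have "orbit_pm (x, v) \<noteq> fscale tangent_RP 0 (orbit_pm (x, v))"
    using assms(2) by (auto simp: fscale_tangent_RP orbit_pm_eq_iff)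
  then show ?thesis
    using conjunct2[OF g[unfolded fiberwise_metric_def], THEN bspec, OF orbit_pm_in_fiber(2)[OF assms(1)]]
      orbit_pm_in_fiber(1)[OF assms(1)] unfolding sqnorm_def by simp
qed

lemma continuous_on_sqnorm: "continuous_on tangent_sphere sqnorm"
proof -
  let ?T = "total (tangent_RP :: ((((real^'n) \<times> (real^'n)) set, (real^'n) set) vbundle))"
  let ?P = "subtopology (prod_topology ?T ?T) {(c, d). proj tangent_RP c = proj tangent_RP d}"
  have "continuous_map (top_of_set tangent_sphere) ?P (\<lambda>p. (orbit_pm p, orbit_pm p))"
    by (auto simp: continuous_map_in_subtopology intro!: continuous_map_pairedI continuous_map_orbit_pm)
  moreover have "continuous_map ?P euclideanreal (\<lambda>(c, d). g c d)"
    using g by (simp add: fiberwise_metric_def)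
  ultimately have "continuous_map (top_of_set tangent_sphere) euclideanreal ((\<lambda>(c, d). g c d) \<circ> (\<lambda>p. (orbit_pm p, orbit_pm p)))"
    by (rule continuous_map_compose)
  then show ?thesis by (simp add: comp_def sqnorm_def[abs_def])
qed

text \<open>The second vector is normalized by \<open>g\<close> instead of the Euclidean norm, since
  its orbit has to lie in the sphere bundle of \<open>g\<close>.\<close>

definition orthonormalized :: "(real^'n) \<times> (real^'n) \<Rightarrow> (real^'n) \<times> (real^'n)" where
  "orthonormalized p = (let x = fst p /\<^sub>R norm (fst p); v = perp (fst p) (snd p)
     in (x, v /\<^sub>R sqrt (sqnorm (x, v))))"

definition frame_point :: "(real^'n) \<times> (real^'n) \<Rightarrow> ((real^'n) \<times> (real^'n)) set" where
  "frame_point p = orbit_pm (orthonormalized p)"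

lemma frame_in_tangent_sphere:
  assumes "p \<in> frames"
  shows "(fst p /\<^sub>R norm (fst p), perp (fst p) (snd p)) \<in> tangent_sphere"
  using assms by (auto simp: frames_def tangent_sphere_def inner_perp)

lemma orthonormalized_in_tangent_sphere: "p \<in> frames \<Longrightarrow> orthonormalized p \<in> tangent_sphere"
  unfolding orthonormalized_def Let_def by (intro tangent_sphere_scale frame_in_tangent_sphere)

lemma sqnorm_orthonormalized:
  assumes "p \<in> frames"
  shows "sqnorm (orthonormalized p) = 1"
proof -
  have "sqnorm (fst p /\<^sub>R norm (fst p), perp (fst p) (snd p)) > 0"
    by (rule sqnorm_pos[OF frame_in_tangent_sphere[OF assms]]) (use assms in \<open>simp add: frames_def\<close>)
  then show ?thesis
    unfolding orthonormalized_def Let_def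
    by (subst sqnorm_scale[OF frame_in_tangent_sphere[OF assms]]) (simp add: power_inverse)
qed

lemma continuous_on_orthonormalized: "continuous_on frames orthonormalized"
proof -
  have perp: "continuous_on frames (\<lambda>p :: (real^'n) \<times> (real^'n). perp (fst p) (snd p))"
    by (rule continuous_on_perp) (auto simp: frames_def)
  have c: "continuous_on frames (\<lambda>p :: (real^'n) \<times> (real^'n). (fst p /\<^sub>R norm (fst p), perp (fst p) (snd p)))"
    by (intro continuous_intros perp) (auto simp: frames_def)
  have "continuous_on frames (\<lambda>p. sqnorm (fst p /\<^sub>R norm (fst p), perp (fst p) (snd p)))"
    by (rule continuous_on_compose2[OF continuous_on_sqnorm c]) (use frame_in_tangent_sphere in auto)
  moreover have "sqnorm (fst p /\<^sub>R norm (fst p), perp (fst p) (snd p)) \<noteq> 0" if "p \<in> frames" for p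
    using sqnorm_pos[OF frame_in_tangent_sphere[OF that]] that by (simp add: frames_def)
  ultimately show ?thesis
    unfolding orthonormalized_def Let_def by (intro continuous_intros perp) (auto simp: frames_def)
qed

abbreviation "sphere_RP \<equiv> sphere_bundle (tangent_RP :: ((((real^'n) \<times> (real^'n)) set, (real^'n) set) vbundle)) g"

lemma topspace_sphere_RP: "topspace sphere_RP = orbit_pm ` {p \<in> tangent_sphere. sqnorm p = 1}"
  by (auto simp: sphere_bundle_def topspace_total_RP sqnorm_def)

lemma continuous_map_frame_point: "continuous_map (top_of_set frames) sphere_RP frame_point"
proof -
  have "continuous_map (top_of_set frames) (top_of_set tangent_sphere) orthonormalized"
    using continuous_on_orthonormalized orthonormalized_in_tangent_sphere by auto
  then have "continuous_map (top_of_set frames) (total tangent_RP) frame_point"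
    unfolding frame_point_def[abs_def]
    using continuous_map_compose[OF _ continuous_map_orbit_pm] by (simp only: comp_def)
  then show ?thesis
    using sqnorm_orthonormalized
    by (auto simp: sphere_bundle_def continuous_map_in_subtopology frame_point_def sqnorm_def)
qed

text \<open>The pairs \<open>(- x, v)\<close> and \<open>(x, - v)\<close> form one orbit, so a sign
  change in either vector becomes the antipode. This is why the pulled-back labels are odd under
  both flips.\<close>

lemma frame_point_minus:
  assumes "(x, y) \<in> frames"
  shows "frame_point (- x, y) = antipode tangent_RP (frame_point (x, y))"
    "frame_point (x, - y) = antipode tangent_RP (frame_point (x, y))"
proof -
  let ?x = "x /\<^sub>R norm x" and ?v = "perp x y"
  have T: "(?x, ?v) \<in> tangent_sphere" using frame_in_tangent_sphere[OF assms] by simp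
  have "sqnorm (- ?x, ?v) = sqnorm (?x, - ?v)"
    using orbit_pm_minus[of "(- ?x, ?v)"] by (simp add: sqnorm_def)
  then have n: "sqnorm (- ?x, ?v) = sqnorm (?x, ?v)" "sqnorm (?x, - ?v) = sqnorm (?x, ?v)"
    using sqnorm_minus[OF T] by simp_all
  have o: "orbit_pm (- ?x, w) = orbit_pm (?x, - w)" for w :: "real^'n"
    using orbit_pm_minus[of "(- ?x, w)"] by simp
  show "frame_point (- x, y) = antipode tangent_RP (frame_point (x, y))"
    using n o by (simp add: frame_point_def orthonormalized_def Let_def perp_minus antipode_RP)
  show "frame_point (x, - y) = antipode tangent_RP (frame_point (x, y))"
    using n by (simp add: frame_point_def orthonormalized_def Let_def perp_minus antipode_RP)
qed

lemma sphere_RP_cases: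
  assumes "c \<in> topspace sphere_RP"
  obtains p where "p \<in> frames" "norm (fst p) = 1" "frame_point p = c"
proof -
  obtain x v where xv: "(x, v) \<in> tangent_sphere" "sqnorm (x, v) = 1" "c = orbit_pm (x, v)"
    using assms by (auto simp: topspace_sphere_RP)
  then have "v \<noteq> 0" using sqnorm_zero by auto
  moreover have "norm x = 1" "x \<noteq> 0" "perp x v = v" using xv(1) by (auto simp: tangent_sphere_def perp_orthogonal)
  ultimately show thesis
    using that[of "(x, v)"] xv by (auto simp: frames_def frame_point_def orthonormalized_def)
qed

lemma antipode_sphere_RP:
  assumes "c \<in> topspace sphere_RP"
  shows "antipode tangent_RP c \<in> topspace sphere_RP" "antipode tangent_RP (antipode tangent_RP c) = c"
proof -
  obtain x v where xv: "(x, v) \<in> tangent_sphere" "sqnorm (x, v) = 1" "c = orbit_pm (x, v)"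
    using assms by (auto simp: topspace_sphere_RP)
  then have "(x, - v) \<in> tangent_sphere" "sqnorm (x, - v) = 1"
    using sqnorm_minus[OF xv(1)] by (simp_all add: tangent_sphere_def)
  then show "antipode tangent_RP c \<in> topspace sphere_RP" "antipode tangent_RP (antipode tangent_RP c) = c"
    by (simp_all add: xv(3) antipode_RP topspace_sphere_RP)
qed

text \<open>This inverts the Gram--Schmidt process; the vector \<open>a\<close> selects one of the two orthonormal
  pairs in an orbit.\<close>

lemma frame_point_inj:
  assumes "p \<in> frames" "q \<in> frames" "frame_point p = frame_point q"
    "fst p \<bullet> a > 0" "fst q \<bullet> a > 0" "norm (fst p) = norm (fst q)" "fst p \<bullet> snd p = fst q \<bullet> snd q"
    "norm (snd p) = norm (snd q)"
  shows "p = q"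
proof -
  have "orthonormalized p = orthonormalized q \<or> orthonormalized p = - orthonormalized q"
    using assms(3) by (simp add: frame_point_def orbit_pm_eq_iff)
  \<comment> \<open>The positive inner products with \<open>a\<close> exclude the other
    representative of the orbit.\<close>
  moreover have "orthonormalized p \<noteq> - orthonormalized q"
  proof
    assume "orthonormalized p = - orthonormalized q"
    then have "fst p /\<^sub>R norm (fst p) = - (fst q /\<^sub>R norm (fst q))" by (auto simp: orthonormalized_def Let_def)
    then have "inverse (norm (fst q)) *\<^sub>R fst p = inverse (norm (fst q)) *\<^sub>R (- fst q)"
      using assms(6) by simp
    then have "fst p = - fst q" using assms(2) by (simp only: scaleR_cancel_left) (auto simp: frames_def)
    then show False using assms(4,5) by simp
  qed
  ultimately have o: "orthonormalized p = orthonormalized q" by blast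
  then have "fst p /\<^sub>R norm (fst p) = fst q /\<^sub>R norm (fst q)" by (auto simp: orthonormalized_def Let_def)
  then have x: "fst p = fst q" using assms(1,2,6) by (auto simp: frames_def)
  define k where "k r = inverse (sqrt (sqnorm (fst r /\<^sub>R norm (fst r), perp (fst r) (snd r))))" for r
  have k: "k r > 0" if "r \<in> frames" for r
    using sqnorm_pos[OF frame_in_tangent_sphere[OF that]] that by (simp add: k_def frames_def)
  have v: "k p *\<^sub>R perp (fst p) (snd p) = k q *\<^sub>R perp (fst q) (snd q)"
    using arg_cong[OF o, of snd] by (simp add: orthonormalized_def Let_def k_def)
  \<comment> \<open>By \<open>v\<close> the two perpendicular parts are positive multiples of each
    other. Their lengths agree by Pythagoras, as the components along the common first vector are
    equal.\<close>
  have decomp: "(norm (snd r))\<^sup>2 = (norm (perp (fst r) (snd r)))\<^sup>2 + ((fst r \<bullet> snd r) / (fst r \<bullet> fst r))\<^sup>2 * (norm (fst r))\<^sup>2"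
    for r :: "(real^'n) \<times> (real^'n)"
  proof -
    let ?u = "perp (fst r) (snd r) + ((fst r \<bullet> snd r) / (fst r \<bullet> fst r)) *\<^sub>R fst r"
    have d: "snd r = ?u" by (simp add: perp_def)
    have "(norm (snd r))\<^sup>2 = (norm ?u)\<^sup>2"
      by (rule arg_cong[where f = "\<lambda>z. (norm z)\<^sup>2", OF d])
    also have "\<dots> = (norm (perp (fst r) (snd r)))\<^sup>2 + (norm (((fst r \<bullet> snd r) / (fst r \<bullet> fst r)) *\<^sub>R fst r))\<^sup>2"
      by (rule norm_add_Pythagorean) (use inner_perp[of "fst r" "snd r"] in \<open>simp add: orthogonal_def inner_commute\<close>)
    finally show ?thesis by (simp only: norm_scaleR power_mult_distrib power2_abs)
  qed
  have "(norm (perp (fst p) (snd p)))\<^sup>2 = (norm (perp (fst q) (snd q)))\<^sup>2"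
    using decomp[of p] decomp[of q] assms(7,8) by (simp add: x)
  then have nv: "norm (perp (fst p) (snd p)) = norm (perp (fst q) (snd q))" by simp
  have "norm (k p *\<^sub>R perp (fst p) (snd p)) = norm (k q *\<^sub>R perp (fst q) (snd q))" using v by simp
  moreover have "norm (perp (fst q) (snd q)) \<noteq> 0" using assms(2) by (simp add: frames_def)
  ultimately have "\<bar>k p\<bar> = \<bar>k q\<bar>" using nv by simp
  then have "k p = k q" using k[OF assms(1)] k[OF assms(2)] by simp
  then have "perp (fst p) (snd p) = perp (fst q) (snd q)" using v k[OF assms(1)] k[OF assms(2)] by auto
  then have "snd p = snd q" using x assms(7) by (simp add: perp_def)
  with x show ?thesis by (simp add: prod_eq_iff)
qed

end


section \<open>Nice colorings\<close>

lemma sign_changes_alternating: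
  "alternating s xs \<Longrightarrow> s \<noteq> 0 \<Longrightarrow> sign_changes xs = length xs - 1"
proof (induction xs arbitrary: s)
  case (Cons x xs)
  then show ?case by (cases xs) fastforce+
qed auto

context
  fixes g :: "((real^'n) \<times> (real^'n)) set \<Rightarrow> ((real^'n) \<times> (real^'n)) set \<Rightarrow> real"
    and K :: "'k::euclidean_space set set"
    and h :: "'k \<Rightarrow> ((real^'n) \<times> (real^'n)) set"
    and lab :: "'k \<Rightarrow> int"
  assumes metric: "fiberwise_metric (tangent_RP :: (((real^'n) \<times> (real^'n)) set, (real^'n) set) vbundle) g"
    and nice: "nice_coloring (tangent_RP :: (((real^'n) \<times> (real^'n)) set, (real^'n) set) vbundle) g K h lab"
begin

abbreviation (input) "invol \<equiv> transport K h (antipode tangent_RP)"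

definition locate :: "(real^'n) \<times> (real^'n) \<Rightarrow> 'k" where
  "locate p = inv_into (\<Union>K) h (frame_point g p)"

lemma complex: "simplicial_complex K"
  and homeo: "homeomorphic_map (top_of_set (\<Union>K)) (sphere_bundle tangent_RP g) h"
  and simplicial: "simplicial_self_map K invol"
  and lab_invol: "\<And>v. v \<in> vertices K \<Longrightarrow> lab (invol v) = - lab v"
  and lab_nonzero: "\<And>v. v \<in> vertices K \<Longrightarrow> lab v \<noteq> 0"
  and lab_adjacent: "\<And>v w. v \<in> vertices K \<Longrightarrow> w \<in> vertices K \<Longrightarrow> v \<noteq> w \<Longrightarrow> closed_segment v w \<in> K \<Longrightarrow> lab v \<noteq> - lab w"
  using nice by (auto simp: nice_coloring_def triangulates_def)

lemma bij_h: "bij_betw h (\<Union>K) (topspace (sphere_bundle tangent_RP g))"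
  using homeomorphic_imp_surjective_map[OF homeo] homeomorphic_imp_injective_map[OF homeo]
  by (simp add: bij_betw_def)

lemma h_inv: "c \<in> topspace (sphere_bundle tangent_RP g) \<Longrightarrow> inv_into (\<Union>K) h c \<in> \<Union>K \<and> h (inv_into (\<Union>K) h c) = c"
  using bij_h by (metis bij_betw_imp_surj_on f_inv_into_f inv_into_into)

lemma continuous_map_h_inv:
  "continuous_map (sphere_bundle tangent_RP g) (top_of_set (\<Union>K)) (inv_into (\<Union>K) h)"
proof -
  obtain k where k: "homeomorphic_maps (top_of_set (\<Union>K)) (sphere_bundle tangent_RP g) h k"
    using homeo homeomorphic_map_maps by blast
  then have c: "continuous_map (sphere_bundle tangent_RP g) (top_of_set (\<Union>K)) k"
    by (simp add: homeomorphic_maps_def)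
  have "k c = inv_into (\<Union>K) h c" if "c \<in> topspace (sphere_bundle tangent_RP g)" for c
  proof -
    have "h (k c) = c" "k c \<in> \<Union>K"
      using k that continuous_map_image_subset_topspace[OF c] by (auto simp: homeomorphic_maps_def)
    then show ?thesis using bij_h by (metis bij_betw_imp_inj_on inv_into_f_f)
  qed
  then show ?thesis using c continuous_map_eq by blast
qed

lemma frame_point_in: "p \<in> frames \<Longrightarrow> frame_point g p \<in> topspace (sphere_bundle tangent_RP g)"
  using continuous_map_image_subset_topspace[OF continuous_map_frame_point[OF metric]] by auto

lemma locate: "p \<in> frames \<Longrightarrow> locate p \<in> \<Union>K" "p \<in> frames \<Longrightarrow> h (locate p) = frame_point g p"
  using h_inv frame_point_in unfolding locate_def by blast+

lemma continuous_on_locate: "continuous_on frames locate"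
proof -
  have "continuous_map (top_of_set frames) (top_of_set (\<Union>K)) (inv_into (\<Union>K) h \<circ> frame_point g)"
    by (rule continuous_map_compose[OF continuous_map_frame_point[OF metric] continuous_map_h_inv])
  moreover have "inv_into (\<Union>K) h \<circ> frame_point g = locate"
    by (auto simp: locate_def)
  ultimately show ?thesis using continuous_map_into_fulltopology by fastforce
qed

lemma locate_minus:
  assumes "(x, y) \<in> frames"
  shows "locate (- x, y) = invol (locate (x, y))" "locate (x, - y) = invol (locate (x, y))"
  unfolding transport_def locate(2)[OF assms]
  by (simp_all add: locate_def frame_point_minus[OF metric assms])

lemma invol:
  assumes "x \<in> \<Union>K"
  shows "invol x \<in> \<Union>K" "invol (invol x) = x"
proof -
  have hx: "h x \<in> topspace (sphere_bundle tangent_RP g)" using bij_h assms by (metis bij_betwE)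
  note a = antipode_sphere_RP[OF metric hx]
  show "invol x \<in> \<Union>K" using h_inv[OF a(1)] by (simp add: transport_def)
  have "invol (invol x) = inv_into (\<Union>K) h (h x)"
    using h_inv[OF a(1)] a(2) by (simp add: transport_def)
  also have "\<dots> = x" using bij_h assms by (meson bij_betw_imp_inj_on inv_into_f_f)
  finally show "invol (invol x) = x" .
qed

lemma invol_simplex: "\<sigma> \<in> K \<Longrightarrow> invol ` \<sigma> \<in> K"
  using simplicial by (simp add: simplicial_self_map_def)

lemma invol_vertex: "v \<in> vertices K \<Longrightarrow> invol v \<in> vertices K"
  using invol_simplex[of "{v}"] by (simp add: vertices_def)

lemma invol_open_star:
  assumes "x \<in> open_star K {w}"
  shows "invol x \<in> open_star K {invol w}"
proof -
  have x: "x \<in> \<Union>K" using assms by (simp add: open_star_def)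
  have "invol w \<in> \<rho>" if "\<rho> \<in> K" "invol x \<in> \<rho>" for \<rho>
  proof -
    have "x \<in> invol ` \<rho>" using invol(2)[OF x] that(2) by (metis imageI)
    then have "w \<in> invol ` \<rho>" using assms invol_simplex[OF that(1)] unfolding open_star_def by blast
    then obtain z where z: "z \<in> \<rho>" "w = invol z" by blast
    then have "invol w = z" using invol(2)[of z] that(1) by blast
    then show ?thesis using z by simp
  qed
  then show ?thesis using invol(1)[OF x] by (simp add: open_star_def)
qed

lemma no_opposite_labels:
  assumes "\<sigma> \<in> K" "v \<in> vertices K \<inter> \<sigma>" "w \<in> vertices K \<inter> \<sigma>"
  shows "lab v \<noteq> - lab w"
proof (cases "v = w")
  case True
  have "lab v \<noteq> 0" using lab_nonzero assms(2) by blast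
  then show ?thesis using True by simp
next
  case False
  have "convex hull {v, w} \<in> K"
    by (rule simplex_faces(4)[OF complex assms(1)]) (use assms(2,3) in blast)
  then show ?thesis
    using lab_adjacent[of v w] assms(2,3) False by (simp add: segment_convex_hull)
qed

lemma open_locate_vimage:
  assumes "openin (top_of_set (\<Union>K)) S"
  shows "open {p \<in> frames. locate p \<in> S}"
proof -
  have "openin (top_of_set frames) (frames \<inter> locate -` S)"
    by (rule continuous_openin_preimage[OF continuous_on_locate _ assms]) (use locate(1) in blast)
  then have "open (frames \<inter> locate -` S)" using open_frames openin_open_trans by blast
  moreover have "frames \<inter> locate -` S = {p \<in> frames. locate p \<in> S}" by blast
  ultimately show ?thesis by simp
qed

text \<open>The inner product of the two vectors serves as one more coordinate with the two labels
  \<open>\<plusminus> (N + 1)\<close>; as these are the largest in absolute value, at most the last entry of an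
  alternating sequence is one of them.\<close>

lemma alternating_face:
  assumes card: "CARD('n) = 2 ^ r + 1"
  obtains W ls s where "W \<subseteq> vertices K" "convex hull W \<in> K" "\<not> affine_dependent W"
    "card W = 2 ^ (r + 1) - 1" "lab ` W = set ls" "length ls = 2 ^ (r + 1) - 1"
    "sorted_wrt (<) (map abs ls)" "alternating s ls"
proof -
  obtain N :: nat where N: "\<And>v. v \<in> vertices K \<Longrightarrow> \<bar>lab v\<bar> \<le> int N"
    using nice by (auto simp: nice_coloring_def)
  define M where "M = int N + 1"
  define V where "V l = (\<Union>w\<in>{w\<in>vertices K. lab w = l}. open_star K {w})" for l
  \<comment> \<open>The labels \<open>M\<close> and \<open>- M\<close> record the sign of the inner
    product; any other \<open>l\<close> stands for the frames located in the open star of a vertex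
    labeled \<open>l\<close>. Orthogonal pairs of nonzero vectors are frames, so nothing is left
    uncovered.\<close>
  define U where "U l = (if l = M then {p :: (real^'n) \<times> (real^'n). 0 < fst p \<bullet> snd p}
    else if l = - M then {p. fst p \<bullet> snd p < 0} else {p \<in> frames. locate p \<in> V l})" for l
  have "M > 0" by (simp add: M_def)
  have lab_M: "lab w \<noteq> M" "lab w \<noteq> - M" if "w \<in> vertices K" for w using N[OF that] by (auto simp: M_def)
  have V_opp: "z \<notin> V (- l)" if "z \<in> V l" for z l
  proof
    assume "z \<in> V (- l)"
    then obtain v w where vw: "v \<in> vertices K" "lab v = l" "z \<in> open_star K {v}"
       "w \<in> vertices K" "lab w = - l" "z \<in> open_star K {w}"
      using \<open>z \<in> V l\<close> unfolding V_def by blast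
    then obtain \<rho> where "\<rho> \<in> K" "v \<in> \<rho>" "w \<in> \<rho>" unfolding open_star_def by blast
    then show False using no_opposite_labels[of \<rho> v w] vw by simp
  qed
  have V_invol: "invol z \<in> V (- l)" if "z \<in> V l" for z l
    using that invol_open_star invol_vertex lab_invol unfolding V_def by fastforce
  let ?X = "(octahedral_sphere :: (real^'n) set) \<times> (octahedral_sphere :: (real^'n) set)"
  have ex: "\<exists>p s ls. p \<in> ?X \<and> length ls = Suc ((2 ^ r - 1) + 2 ^ r) \<and> sorted_wrt (<) (map abs ls) \<and>
      alternating s ls \<and> (\<forall>l\<in>set ls. p \<in> U l)"
  proof (rule fan_covering[of U "2 ^ r - 1" "2 ^ r"])
    show "open (U l)" for l
    proof -
      have "openin (top_of_set (\<Union>K)) (V l)" unfolding V_def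
        by (intro openin_Union) (use openin_open_star[OF complex] in auto)
      then show ?thesis unfolding U_def
        by (auto intro!: open_locate_vimage open_Collect_less continuous_intros)
    qed
    show "?X \<subseteq> (\<Union>l. U l)"
    proof
      fix p assume "p \<in> ?X"
      then have "fst p \<noteq> 0" "snd p \<noteq> 0" by (auto simp: octahedral_sphere_def)
      show "p \<in> (\<Union>l. U l)"
      proof (cases "fst p \<bullet> snd p = 0")
        case True
        then have p: "p \<in> frames" using \<open>fst p \<noteq> 0\<close> \<open>snd p \<noteq> 0\<close> by (simp add: frames_def perp_orthogonal)
        obtain w where w: "w \<in> vertices K" "locate p \<in> open_star K {w}"
          using open_star_cover[OF complex locate(1)[OF p]] .
        then have "p \<in> U (lab w)" using lab_M[of w] p by (auto simp: U_def V_def)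
        then show ?thesis by blast
      next
        case False
        then have "p \<in> U M \<or> p \<in> U (- M)" using \<open>M > 0\<close> by (auto simp: U_def)
        then show ?thesis by blast
      qed
    qed
    show "flip1 p \<in> U (- l)" "flip2 p \<in> U (- l)" if "p \<in> U l" for p l
    proof -
      obtain x y where p: "p = (x, y)" by (cases p)
      have "(- x, y) \<in> frames \<and> (x, - y) \<in> frames" if "(x, y) \<in> frames"
        using that by (simp add: frames_def perp_minus)
      moreover have "locate (- x, y) \<in> V (- l) \<and> locate (x, - y) \<in> V (- l)" if "(x, y) \<in> frames" "locate (x, y) \<in> V l"
        using locate_minus[OF that(1)] V_invol[OF that(2)] by simp
      ultimately show "flip1 p \<in> U (- l)" "flip2 p \<in> U (- l)"
        using that \<open>M > 0\<close> by (auto simp: U_def p flip1_def flip2_def split: if_splits)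
    qed
    show "p \<notin> U (- l)" if "p \<in> U l" for p l
      using that V_opp[of "locate p" l] \<open>M > 0\<close> by (auto simp: U_def split: if_splits)
    \<comment> \<open>The coefficient lies in row \<open>2 ^ (r + 1) - 1\<close>, whose entries are
      all odd.\<close>
    have "(2 ^ r - 1) + 2 ^ r = (2 ^ (r + 1) - 1 :: nat)" by simp
    then show "odd (((2 ^ r - 1) + 2 ^ r) choose (2 ^ r - 1) :: nat)"
      using odd_binomial_two_power_minus_1[of "2 ^ r - 1" "r + 1"] by (simp add: less_imp_diff_less)
    show "2 ^ r - 1 < DIM(real^'n)" "2 ^ r < DIM(real^'n)" using card by simp_all
  qed blast
  then obtain p s ls where ls: "length ls = Suc ((2 ^ r - 1) + 2 ^ r)" "sorted_wrt (<) (map abs ls)"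
      "alternating s ls" "\<forall>l\<in>set ls. p \<in> U l" by blast
  \<comment> \<open>The last entry is dropped whether or not it is \<open>M\<close> or
    \<open>- M\<close>. All earlier absolute values are then strictly below
    \<open>M\<close>.\<close>
  define ts where "ts = butlast ls"
  have two: "(2::nat) ^ r \<ge> 1" by simp
  have "ls \<noteq> []" using ls(1) by auto
  then have split: "ls = ts @ [last ls]" by (simp add: ts_def)
  have len: "length ts = 2 ^ (r + 1) - 1" using ls(1) two by (simp add: ts_def)
  have alt_app: "alternating s xs" if "alternating s (xs @ ys)" for s xs ys
    using that by (induction xs arbitrary: s) auto
  have ts: "sorted_wrt (<) (map abs ts)" "alternating s ts"
    using ls(2,3) alt_app[of s ts "[last ls]"] split by (metis map_append sorted_wrt_append, metis)
  have pV: "p \<in> frames \<and> locate p \<in> V l" if "l \<in> set ts" for l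
  proof -
    have "sorted_wrt (<) (map abs ts @ [\<bar>last ls\<bar>])" using ls(2) split by (metis list.simps(8,9) map_append)
    then have "\<bar>l\<bar> < \<bar>last ls\<bar>" using that by (auto simp: sorted_wrt_append)
    moreover have "\<bar>last ls\<bar> \<le> M"
    proof (cases "last ls = M \<or> last ls = - M")
      case False
      have "p \<in> U (last ls)" using ls(4) \<open>ls \<noteq> []\<close> by simp
      then obtain w where "w \<in> vertices K" "lab w = last ls" using False by (auto simp: U_def V_def)
      then show ?thesis using N[of w] by (simp add: M_def)
    qed (use \<open>M > 0\<close> in auto)
    ultimately have "l \<noteq> M" "l \<noteq> - M" by auto
    moreover have "p \<in> U l" using ls(4) split that by (metis Un_iff set_append)
    ultimately show ?thesis by (simp add: U_def)
  qed
  then have "\<forall>l\<in>set ts. \<exists>w\<in>vertices K. lab w = l \<and> locate p \<in> open_star K {w}" by (fastforce simp: V_def)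
  then obtain w where w: "\<And>l. l \<in> set ts \<Longrightarrow> w l \<in> vertices K" "\<And>l. l \<in> set ts \<Longrightarrow> lab (w l) = l"
    "\<And>l. l \<in> set ts \<Longrightarrow> locate p \<in> open_star K {w l}" by metis
  have "1 < (2::nat) ^ (r + 1)" by (rule one_less_power) auto
  then have "0 < length ts" unfolding len by (simp only: zero_less_diff)
  then have "ts \<noteq> []" by simp
  then have "locate p \<in> \<Union>K" using w(3)[of "hd ts"] by (simp add: open_star_def)
  then obtain \<rho> where r: "\<rho> \<in> K" "locate p \<in> \<rho>" by blast
  \<comment> \<open>The open stars of all chosen vertices contain \<open>locate p\<close>, so the
    simplex \<open>\<rho>\<close> through that point has them among its vertices.\<close>
  define W where "W = w ` set ts"
  have W: "W \<subseteq> vertices K \<inter> \<rho>" using w(1,3) r unfolding W_def open_star_def by blast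
  have "inj_on w (set ts)" using w(2) by (metis inj_onI)
  moreover have "distinct ts" using ts(1) by (metis distinct_map strict_sorted_iff)
  ultimately have "card W = length ts" unfolding W_def by (simp add: card_image distinct_card)
  moreover have "convex hull W \<in> K" using simplex_faces(4)[OF complex r(1) W] .
  moreover have "\<not> affine_dependent W"
    using affine_independent_subset[OF simplex_faces(2)[OF complex r(1)] W] .
  moreover have "lab ` W = set ts" using w(2) by (auto simp: W_def image_iff)
  ultimately show thesis using that[of W ts s] W ts len by simp
qed

text \<open>Since opposite labels do not occur in \<open>\<sigma>\<close>, distinct labels have
  distinct absolute values. So \<open>ls\<close> is a subsequence of the sorted labels, and its own
  sign changes are a lower bound.\<close>

lemma Alt_ge:
  assumes "\<sigma> \<in> K" "W \<subseteq> vertices K \<inter> \<sigma>" "lab ` W = set ls" "sorted_wrt (<) (map abs ls)" "alternating s ls"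
  shows "length ls - 1 \<le> Alt K lab \<sigma>"
proof (cases ls)
  case (Cons a as)
  let ?S = "lab ` (vertices K \<inter> \<sigma>)"
  have fin: "finite ?S" using simplex_faces(1)[OF complex assms(1)] by simp
  have nz: "x \<noteq> 0" if "x \<in> ?S" for x using that lab_nonzero by fastforce
  have "x = y" if "x \<in> ?S" "y \<in> ?S" "\<bar>x\<bar> = \<bar>y\<bar>" for x y
  proof -
    have "x \<noteq> - y" using that(1,2) no_opposite_labels[OF assms(1)] by auto
    then show ?thesis using that(3) by (simp add: abs_eq_iff)
  qed
  then have "inj_on abs ?S" by (intro inj_onI)
  moreover have "set ls \<subseteq> ?S" using image_mono[OF assms(2), of lab] by (simp only: assms(3))
  ultimately have "subseq ls (sort_key abs (sorted_list_of_set ?S))"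
    using fin by (intro sorted_sublist_abs[OF assms(4)])
  then have "sign_changes ls \<le> Alt K lab \<sigma>"
    unfolding Alt_def using fin nz by (intro sign_changes_subseq) auto
  moreover have "a \<in> ?S" using Cons assms(2,3) by (metis image_mono list.set_intros(1) subsetD)
  then have "s \<noteq> 0" using nz[of a] assms(5) Cons by (auto simp: sgn_0_0)
  ultimately show ?thesis using sign_changes_alternating[OF assms(5)] by simp
qed simp

text \<open>Otherwise the open star of \<open>\<sigma>\<close> lies in one simplex
  \<open>\<tau>\<close>, and an open set of frames embeds into the product of \<open>\<tau>\<close>
  with three real coordinates, against \<open>open_map_into_coface\<close>. The dimension condition
  is \<open>2 * CARD('n) = (aff_dim \<sigma> + 1) + 3\<close>.\<close>

lemma two_cofaces:
  assumes "\<sigma> \<in> K" "\<sigma> \<noteq> {}" "aff_dim \<sigma> + 4 = 2 * int CARD('n)"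
  obtains \<tau> \<tau>' where "\<tau> \<in> K" "\<tau>' \<in> K" "\<sigma> \<subset> \<tau>" "\<sigma> \<subset> \<tau>'" "\<tau> \<noteq> \<tau>'"
proof (rule ccontr)
  assume no: "\<not> thesis"
  note coface = that
  have cvx: "convex \<rho>" if "\<rho> \<in> K" for \<rho>
    using complex that convex_simplex unfolding simplicial_complex_def by blast
  obtain \<tau> where t: "\<tau> \<in> K" "\<sigma> face_of \<tau>" "open_star K \<sigma> \<subseteq> \<tau>" "\<tau> = \<sigma> \<or> aff_dim \<tau> = aff_dim \<sigma> + 1"
    by (rule at_most_one_coface[OF complex assms(1)]) (use no coface in blast, assumption)
  obtain z where z: "z \<in> rel_interior \<sigma>" using rel_interior_eq_empty[OF cvx[OF assms(1)]] assms(2) by blast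
  have z_star: "z \<in> open_star K \<sigma>" using rel_interior_subset_open_star[OF complex assms(1)] z by blast
  then have zK: "z \<in> \<Union>K" by (simp add: open_star_def)
  have "h z \<in> topspace (sphere_bundle tangent_RP g)" using bij_h zK by (metis bij_betwE)
  then obtain p where p: "p \<in> frames" "norm (fst p) = 1" "frame_point g p = h z"
    by (rule sphere_RP_cases[OF metric])
  have lp: "locate p = z" using p(3) bij_h zK unfolding locate_def by (metis bij_betw_imp_inj_on inv_into_f_f)
  \<comment> \<open>Orthonormalization forgets two lengths and an inner product, which are the three
    real coordinates of \<open>F\<close>. The half-space around \<open>fst p\<close> settles the
    common sign of a pair.\<close>
  define \<Omega> where "\<Omega> = {q \<in> frames. locate q \<in> open_star K \<sigma>} \<inter> {q. 0 < fst q \<bullet> fst p}"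
  define F where "F q = (locate q, norm (fst q), fst q \<bullet> snd q, norm (snd q))" for q
  show False
  proof (rule open_map_into_coface[of \<Omega> p F \<tau> \<sigma>])
    show "open \<Omega>" unfolding \<Omega>_def
      by (intro open_Int open_locate_vimage openin_open_star[OF complex] open_Collect_less continuous_intros)
    have "fst p \<bullet> fst p > 0" using p(2) by auto
    then show "p \<in> \<Omega>" using p(1) lp z_star by (simp add: \<Omega>_def)
    have "continuous_on \<Omega> locate" by (rule continuous_on_subset[OF continuous_on_locate]) (auto simp: \<Omega>_def)
    then show "continuous_on \<Omega> F" unfolding F_def by (intro continuous_intros)
    show "inj_on F \<Omega>"
    proof (rule inj_onI)
      fix q q' assume q: "q \<in> \<Omega>" "q' \<in> \<Omega>" "F q = F q'"
      then have "frame_point g q = frame_point g q'"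
        using locate(2)[of q] locate(2)[of q'] by (simp add: \<Omega>_def F_def)
      then show "q = q'"
        using q by (intro frame_point_inj[OF metric, of q q' "fst p"]) (auto simp: \<Omega>_def F_def)
    qed
    show "F ` \<Omega> \<subseteq> \<tau> \<times> UNIV" using t(3) by (auto simp: F_def \<Omega>_def)
    show "fst (F p) \<in> \<sigma>" using lp z rel_interior_subset[of \<sigma>] by (auto simp: F_def)
    show "int DIM((real^'n) \<times> (real^'n)) = aff_dim \<sigma> + 1 + int DIM(real \<times> real \<times> real)"
      using assms(3) by simp
  qed (use t cvx in auto)
qed

lemma card_alternating_pairs:
  assumes "CARD('n) = 2 ^ r + 1"
  shows "card {{\<sigma>, invol ` \<sigma>} | \<sigma>. \<sigma> \<in> K \<and> \<sigma> \<noteq> {} \<and> Alt K lab \<sigma> \<ge> 2 ^ (r + 1) - 2} \<ge> 3"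
proof -
  let ?P = "{{\<sigma>, invol ` \<sigma>} | \<sigma>. \<sigma> \<in> K \<and> \<sigma> \<noteq> {} \<and> Alt K lab \<sigma> \<ge> 2 ^ (r + 1) - 2}"
  obtain W ls s where W: "W \<subseteq> vertices K" "convex hull W \<in> K" "\<not> affine_dependent W"
    "card W = 2 ^ (r + 1) - 1" "lab ` W = set ls" "length ls = 2 ^ (r + 1) - 1"
    "sorted_wrt (<) (map abs ls)" "alternating s ls"
    by (rule alternating_face[OF assms])
  have two: "(2::nat) ^ r \<ge> 1" by simp
  define \<sigma> where "\<sigma> = convex hull W"
  have "1 < (2::nat) ^ (r + 1)" by (rule one_less_power) auto
  then have "0 < card W" unfolding W(4) by (simp only: zero_less_diff)
  then have "W \<noteq> {}" by auto
  then obtain w where w: "w \<in> W" by blast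
  have W\<sigma>: "W \<subseteq> \<sigma>" unfolding \<sigma>_def by (rule hull_subset)
  \<comment> \<open>The dimension is \<open>2 ^ (r + 1) - 2\<close>, that is
    \<open>2 * CARD('n) - 4\<close>, one less than that of the sphere bundle.\<close>
  have "aff_dim \<sigma> = int (card W) - 1"
    using aff_dim_affine_independent[OF W(3)] by (simp add: \<sigma>_def aff_dim_convex_hull)
  also have "int (card W) = 2 * 2 ^ r - 1" using W(4) by (simp add: of_nat_diff)
  finally have "aff_dim \<sigma> + 4 = 2 * int CARD('n)" using assms by simp
  then obtain \<tau> \<tau>' where t: "\<tau> \<in> K" "\<tau>' \<in> K" "\<sigma> \<subset> \<tau>" "\<sigma> \<subset> \<tau>'" "\<tau> \<noteq> \<tau>'"
    using two_cofaces[of \<sigma>] W(2) W\<sigma> w unfolding \<sigma>_def by blast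
  have in_P: "{\<rho>, invol ` \<rho>} \<in> ?P" if "\<rho> \<in> K" "\<sigma> \<subseteq> \<rho>" for \<rho>
  proof -
    have "length ls - 1 \<le> Alt K lab \<rho>"
      by (rule Alt_ge[OF that(1) _ W(5,7,8)]) (use W(1) W\<sigma> that(2) in blast)
    then have "Alt K lab \<rho> \<ge> 2 ^ (r + 1) - 2" using W(6) by simp
    moreover have "\<rho> \<noteq> {}" using that(2) W\<sigma> w by blast
    ultimately show ?thesis using that(1) by blast
  qed
  have distinct: "{\<rho>, invol ` \<rho>} \<noteq> {\<rho>', invol ` \<rho>'}"
    if "\<rho> \<in> K" "\<rho>' \<in> K" "\<sigma> \<subseteq> \<rho>" "\<sigma> \<subseteq> \<rho>'" "\<rho> \<noteq> \<rho>'" for \<rho> \<rho>'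
  proof
    assume "{\<rho>, invol ` \<rho>} = {\<rho>', invol ` \<rho>'}"
    then have "\<rho> = invol ` \<rho>'" using that(5) by (auto simp: doubleton_eq_iff)
    then have "invol w \<in> \<rho>" "w \<in> \<rho>" using that W\<sigma> w by blast+
    moreover have "w \<in> vertices K" using w W(1) by blast
    ultimately show False
      using no_opposite_labels[OF that(1), of "invol w" w] invol_vertex lab_invol by simp
  qed
  have \<sigma>K: "\<sigma> \<in> K" using W(2) by (simp add: \<sigma>_def)
  let ?T = "{{\<sigma>, invol ` \<sigma>}, {\<tau>, invol ` \<tau>}, {\<tau>', invol ` \<tau>'}}"
  have T3: "card ?T = 3"
    using distinct[OF \<sigma>K t(1)] distinct[OF \<sigma>K t(2)] distinct[OF t(1,2)] t by (auto simp: card_insert_if)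
  have T: "?T \<subseteq> ?P" using in_P[OF \<sigma>K] in_P[OF t(1)] in_P[OF t(2)] t(3,4) by blast
  \<comment> \<open>Finiteness matters because \<open>card\<close> of an infinite set is 0.\<close>
  have P: "finite ?P"
  proof (rule finite_subset)
    show "?P \<subseteq> (\<lambda>\<sigma>. {\<sigma>, invol ` \<sigma>}) ` K" by blast
    show "finite ((\<lambda>\<sigma>. {\<sigma>, invol ` \<sigma>}) ` K)" using complex by (simp add: simplicial_complex_def)
  qed
  show ?thesis using card_mono[OF P T] unfolding T3 .
qed

end

theorem mainTheorem5:
  fixes r :: nat
    and g :: "((real^'n) \<times> (real^'n)) set \<Rightarrow> ((real^'n) \<times> (real^'n)) set \<Rightarrow> real"
    and K :: "'k::euclidean_space set set"
    and h :: "'k \<Rightarrow> ((real^'n) \<times> (real^'n)) set"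
    and lab :: "'k \<Rightarrow> int"
  assumes "r \<ge> 1"
    and "CARD('n) = 2 ^ r + 1"
    and "fiberwise_metric (tangent_RP :: (((real^'n) \<times> (real^'n)) set, (real^'n) set) vbundle) g"
    and "nice_coloring (tangent_RP :: (((real^'n) \<times> (real^'n)) set, (real^'n) set) vbundle) g K h lab"
  shows "card {{\<sigma>, transport K h (antipode tangent_RP) ` \<sigma>} | \<sigma>.
           \<sigma> \<in> K \<and> \<sigma> \<noteq> {} \<and> Alt K lab \<sigma> \<ge> 2 ^ (r + 1) - 2} \<ge> 3"
  using card_alternating_pairs[OF assms(3,4,2)] .

end
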